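(* For every constant $K>0$ there exist constants $c,C>0$ (depending only on $K$) such that for all integers $r\ge 2$ and $n$ with $2r-1\le n\le K r^2$, \[ 2^{c\, r^2/n}\;\le\; f(n,r)\;\le\; 2^{C\,(r^2/n)\log_2(n/r)} \;=\; (n/r)^{C r^2/n}. \] That is, $f(n,r)=2^{\tilde{\Theta}(r^2/n)}$ for $3\le 2r-1\le n\le O(r^2)$, where $\tilde\Theta$ hides a factor logarithmic in $n/r$ in the exponent.
   Context: A hypergraph is $r$-uniform if every edge has exactly $r$ vertices. A hypergraph is intersecting if any two edges have non-empty intersection. The cover number $\tau(H)$ of a hypergraph $H$ is the minimum size of a set of vertices meeting every edge. For integers $n\ge 2r-1\ge 3$, $f(n,r)$ denotes the minimum number of edges in an $n$-vertex $r$-uniform intersecting hypergraph with cover number equal to $r$. *)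

theory Defs
  imports Complex_Main
begin

text \<open>A hypergraph is given by its finite vertex set \<open>V\<close>, which may contain vertices lying
  in no edge, and its set of edges \<open>E\<close>.\<close>

definition hypergraph :: "'a set \<Rightarrow> 'a set set \<Rightarrow> bool" where
  "hypergraph V E \<longleftrightarrow> finite V \<and> (\<forall>e\<in>E. e \<subseteq> V)"

definition uniform :: "nat \<Rightarrow> 'a set set \<Rightarrow> bool" where
  "uniform r E \<longleftrightarrow> (\<forall>e\<in>E. card e = r)"

definition intersecting :: "'a set set \<Rightarrow> bool" where
  "intersecting E \<longleftrightarrow> (\<forall>e\<in>E. \<forall>e'\<in>E. e \<inter> e' \<noteq> {})"

definition vertex_cover :: "'a set \<Rightarrow> 'a set set \<Rightarrow> 'a set \<Rightarrow> bool" where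
  "vertex_cover V E T \<longleftrightarrow> T \<subseteq> V \<and> (\<forall>e\<in>E. T \<inter> e \<noteq> {})"

definition cover_number :: "'a set \<Rightarrow> 'a set set \<Rightarrow> nat" where
  "cover_number V E = (LEAST k. \<exists>T. vertex_cover V E T \<and> card T = k)"

definition admissible :: "nat \<Rightarrow> nat \<Rightarrow> 'a set \<Rightarrow> 'a set set \<Rightarrow> bool" where
  "admissible n r V E \<longleftrightarrow> hypergraph V E \<and> card V = n \<and> uniform r E \<and> intersecting E
     \<and> cover_number V E = r"

text \<open>Vertices are taken to be natural numbers, which is no restriction for finite
  hypergraphs. The set over which the minimum is taken is nonempty for \<open>n \<ge> 2 * r - 1\<close> and
  \<open>r \<ge> 1\<close>; see \<open>admissible_exists\<close>.\<close>

definition min_edges :: "nat \<Rightarrow> nat \<Rightarrow> nat" where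
  "min_edges n r = (LEAST m. \<exists>(V :: nat set) E. admissible n r V E \<and> card E = m)"

lemma admissible_exists:
  assumes r: "r \<ge> 1" and n: "n \<ge> 2 * r - 1"
  shows "\<exists>(V :: nat set) E. admissible n r V E"
proof -
  define W where "W = {..<2 * r - 1}"
  define E where "E = {e. e \<subseteq> W \<and> card e = r}"
  have fW: "finite W" and cW: "card W = 2 * r - 1" and WV: "W \<subseteq> {..<n}"
    using n by (auto simp: W_def)
  have int: "e \<inter> e' \<noteq> {}" if "e \<subseteq> W" "card e = r" "e' \<subseteq> W" "card e' = r" for e e'
  proof
    assume "e \<inter> e' = {}"
    then have "card (e \<union> e') = 2 * r"
      using that finite_subset[OF _ fW] by (simp add: card_Un_disjoint)
    moreover have "card (e \<union> e') \<le> card W"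
      using that fW by (intro card_mono) auto
    ultimately show False using cW r by simp
  qed
  have "cover_number {..<n} E = r"
    unfolding cover_number_def
  proof (rule Least_equality)
    have "{..<r} \<subseteq> W" using r by (auto simp: W_def)
    then have "vertex_cover {..<n} E {..<r}"
      unfolding vertex_cover_def E_def using r n int[of "{..<r}"] by auto
    then show "\<exists>T. vertex_cover {..<n} E T \<and> card T = r"
      by (intro exI[of _ "{..<r}"]) simp
  next
    fix k assume "\<exists>T. vertex_cover {..<n} E T \<and> card T = k"
    then obtain T where T: "vertex_cover {..<n} E T" "card T = k" by blast
    show "r \<le> k"
    proof (rule ccontr)
      assume "\<not> r \<le> k"
      have "finite T" using T(1) finite_subset by (auto simp: vertex_cover_def)
      then have "card W - card T \<le> card (W - T)" by (rule diff_card_le_card_Diff)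
      then have "r \<le> card (W - T)" using T(2) cW \<open>\<not> r \<le> k\<close> by simp
      then obtain e where "e \<subseteq> W - T" "card e = r"
        by (meson obtain_subset_with_card_n)
      then have "e \<in> E" "T \<inter> e = {}" by (auto simp: E_def)
      then show False using T(1) by (auto simp: vertex_cover_def)
    qed
  qed
  then have "admissible n r {..<n} E"
    using WV int by (auto simp: admissible_def hypergraph_def uniform_def intersecting_def E_def)
  then show ?thesis by blast
qed

end

theory Submission
  imports Defs "HOL-Algebra.Algebraic_Closure_Type" "HOL-Library.Z2"
begin

text \<open>
  Lower bound: every edge contains an \<open>r / n\<close> fraction of the vertices, so \<open>r - 1\<close> greedily
  chosen vertices leave at most \<open>(1 - r / n) ^ (r - 1) * card E\<close> edges uncovered, which is less
  than one unless \<open>card E \<ge> exp (r * (r - 1) / n)\<close>.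

  Upper bound: take a projective plane of order \<open>q \<approx> n / r\<close>, replace each point by \<open>2 * s - 1\<close>
  copies with \<open>s \<approx> r / q\<close>, and let an edge consist of \<open>s\<close> copies of every point of a line.
  The remainder of \<open>r\<close> modulo \<open>q + 1\<close> is absorbed by a chain of additional disjoint blocks. A set
  of fewer than \<open>r\<close> vertices that meets all of these blocks leaves some line on which it has weight
  at most \<open>2 * s\<close> and fewer than \<open>s\<close> copies of each point, hence it is missed by a fraction
  \<open>q powr (- O(s))\<close> of the edges over this line. By the same greedy argument, now choosing edges
  that avoid potential covers, \<open>q powr O(s)\<close> edges suffice.
\<close>

section \<open>Greedy hitting sets\<close>

lemma ex_frequent_element:
  fixes p :: real
  assumes "finite \<Omega>" "\<Omega> \<noteq> {}" "finite I"
    and sub: "\<And>i. i \<in> I \<Longrightarrow> S i \<subseteq> \<Omega>"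
    and dense: "\<And>i. i \<in> I \<Longrightarrow> p * card \<Omega> \<le> card (S i)"
  shows "\<exists>x\<in>\<Omega>. p * card I \<le> card {i\<in>I. x \<in> S i}"
proof (rule ccontr)
  assume "\<not> ?thesis"
  then have rare: "card {i\<in>I. x \<in> S i} < p * card I" if "x \<in> \<Omega>" for x
    using that by (meson not_le)
  have "(\<Sum>x\<in>\<Omega>. card {i\<in>I. x \<in> S i}) = (\<Sum>i\<in>I. card {x\<in>\<Omega>. x \<in> S i})"
    using sum.swap_restrict[OF assms(1,3), of "\<lambda>_ _. 1::nat" "\<lambda>x i. x \<in> S i"] by simp
  also have "\<dots> = (\<Sum>i\<in>I. card (S i))"
    using sub by (intro sum.cong arg_cong[where f = card]) auto
  finally have double_count: "(\<Sum>x\<in>\<Omega>. real (card {i\<in>I. x \<in> S i})) = (\<Sum>i\<in>I. real (card (S i)))"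
    unfolding of_nat_sum[symmetric] by (rule arg_cong)
  have "(\<Sum>x\<in>\<Omega>. real (card {i\<in>I. x \<in> S i})) < (\<Sum>x\<in>\<Omega>. p * card I)"
    using rare assms(1,2) by (intro sum_strict_mono) auto
  also have "\<dots> = (\<Sum>i\<in>I. p * card \<Omega>)" by simp
  also have "\<dots> \<le> (\<Sum>i\<in>I. real (card (S i)))"
    using dense by (intro sum_mono)
  finally show False using double_count by simp
qed

lemma greedy_hitting_set:
  fixes p :: real
  assumes "finite \<Omega>" "\<Omega> \<noteq> {}" "finite I" "p \<le> 1"
    and sub: "\<And>i. i \<in> I \<Longrightarrow> S i \<subseteq> \<Omega>"
    and dense: "\<And>i. i \<in> I \<Longrightarrow> p * card \<Omega> \<le> card (S i)"
  shows "\<exists>Y\<subseteq>\<Omega>. card Y \<le> k \<and> card {i\<in>I. S i \<inter> Y = {}} \<le> (1 - p) ^ k * card I"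
proof (induction k)
  case 0
  then show ?case by (intro exI[of _ "{}"]) simp
next
  case (Suc k)
  then obtain Y where Y: "Y \<subseteq> \<Omega>" "card Y \<le> k"
    "card {i\<in>I. S i \<inter> Y = {}} \<le> (1 - p) ^ k * card I" by blast
  define J where "J = {i\<in>I. S i \<inter> Y = {}}"
  have finJ: "finite J" using assms(3) by (simp add: J_def)
  obtain x where x: "x \<in> \<Omega>" "p * card J \<le> card {i\<in>J. x \<in> S i}"
    using ex_frequent_element[OF assms(1,2) finJ, of S p] sub dense by (auto simp: J_def)
  have "{i\<in>I. S i \<inter> insert x Y = {}} = J - {i\<in>J. x \<in> S i}" by (auto simp: J_def)
  then have "card {i\<in>I. S i \<inter> insert x Y = {}} = card J - card {i\<in>J. x \<in> S i}"
    using finJ by (simp add: card_Diff_subset)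
  moreover have "card {i\<in>J. x \<in> S i} \<le> card J" using finJ by (intro card_mono) auto
  ultimately have "real (card {i\<in>I. S i \<inter> insert x Y = {}}) \<le> (1 - p) * card J"
    using x(2) by (simp add: algebra_simps of_nat_diff)
  also have "\<dots> \<le> (1 - p) * ((1 - p) ^ k * card I)"
    using Y(3) assms(4) by (intro mult_left_mono) (auto simp: J_def)
  finally have "card {i\<in>I. S i \<inter> insert x Y = {}} \<le> (1 - p) ^ Suc k * card I"
    by (simp add: mult.assoc)
  moreover have "card (insert x Y) \<le> Suc k"
    using Y(2) finite_subset[OF Y(1) assms(1)] by (simp add: card_insert_if)
  ultimately show ?case using Y(1) x(1) by (intro exI[of _ "insert x Y"]) auto
qed

lemma ex_small_hitting_set:
  fixes p :: real
  assumes "finite \<Omega>" "\<Omega> \<noteq> {}" "finite I"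
    and sub: "\<And>i. i \<in> I \<Longrightarrow> S i \<subseteq> \<Omega>"
    and dense: "\<And>i. i \<in> I \<Longrightarrow> p * card \<Omega> \<le> card (S i)"
    and few: "card I < exp (p * k)"
  shows "\<exists>Y\<subseteq>\<Omega>. card Y \<le> k \<and> (\<forall>i\<in>I. S i \<inter> Y \<noteq> {})"
proof (cases "I = {}")
  case True
  then show ?thesis by (intro exI[of _ "{}"]) simp
next
  case False
  then obtain i where i: "i \<in> I" by blast
  have "card (S i) \<le> card \<Omega>" using assms(1) sub[OF i] by (rule card_mono)
  then have "p * card \<Omega> \<le> 1 * card \<Omega>" using dense[OF i] by simp
  then have p: "p \<le> 1"
    using assms(1,2) by (simp add: card_gt_0_iff)
  have "\<exists>Y\<subseteq>\<Omega>. card Y \<le> k \<and> card {i\<in>I. S i \<inter> Y = {}} \<le> (1 - p) ^ k * card I"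
    by (rule greedy_hitting_set) (fact assms p)+
  then obtain Y where Y: "Y \<subseteq> \<Omega>" "card Y \<le> k"
    "card {i\<in>I. S i \<inter> Y = {}} \<le> (1 - p) ^ k * card I"
    by auto
  note Y(3)
  also have "(1 - p) ^ k * card I \<le> exp (- p) ^ k * card I"
    using p exp_ge_add_one_self[of "- p"] by (intro mult_right_mono power_mono) auto
  also have "\<dots> = card I / exp (p * k)"
    by (simp add: exp_of_nat_mult[symmetric] exp_minus field_simps)
  also have "\<dots> < 1" using few by simp
  finally have "{i\<in>I. S i \<inter> Y = {}} = {}" using assms(3) by simp
  then show ?thesis using Y by blast
qed

section \<open>The minimum number of edges\<close>

lemma finite_edges: "hypergraph V E \<Longrightarrow> finite E"
  unfolding hypergraph_def by (meson Pow_iff finite_Pow_iff finite_subset subsetI)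

lemma cover_number_le: "vertex_cover V E T \<Longrightarrow> cover_number V E \<le> card T"
  unfolding cover_number_def by (intro Least_le) blast

lemma card_edges_ge_exp:
  assumes H: "hypergraph V E" "uniform r E" and k: "k < cover_number V E"
  shows "exp (real r * real k / real (card V)) \<le> card E"
proof (rule ccontr)
  assume "\<not> ?thesis"
  then have few: "card E < exp (real r / real (card V) * real k)" by simp
  have V: "finite V" "\<And>e. e \<in> E \<Longrightarrow> e \<subseteq> V" "\<And>e. e \<in> E \<Longrightarrow> card e = r"
    using H by (auto simp: hypergraph_def uniform_def)
  have "E \<noteq> {}"
    using k cover_number_le[of V E "{}"] by (auto simp: vertex_cover_def)
  then have "1 \<le> card E" using finite_edges[OF H(1)] by (simp add: Suc_le_eq card_gt_0_iff)
  then have Vne: "V \<noteq> {}" using few by auto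
  then have "real r / real (card V) * card V \<le> card e" if "e \<in> E" for e
    using that V by simp
  then obtain Y where "Y \<subseteq> V" "card Y \<le> k" "\<forall>e\<in>E. e \<inter> Y \<noteq> {}"
    using ex_small_hitting_set[of V E "\<lambda>e. e", OF V(1) Vne finite_edges[OF H(1)] V(2) _ few]
    by blast
  then have "cover_number V E \<le> card Y"
    by (intro cover_number_le) (auto simp: vertex_cover_def)
  then show False using \<open>card Y \<le> k\<close> k by simp
qed

lemma admissibleI:
  assumes V: "finite V" "card V = n" "\<And>e. e \<in> E \<Longrightarrow> e \<subseteq> V"
    and E: "uniform r E" "intersecting E"
    and no_cover: "\<And>T. T \<subseteq> V \<Longrightarrow> card T < r \<Longrightarrow> \<exists>e\<in>E. e \<inter> T = {}"
    and r: "r \<ge> 1"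
  shows "admissible n r V E"
proof -
  have "cover_number V E = r"
    unfolding cover_number_def
  proof (rule Least_equality)
    obtain e where e: "e \<in> E" using no_cover[of "{}"] r by auto
    then have "vertex_cover V E e" "card e = r"
      using E V(3) by (auto simp: vertex_cover_def intersecting_def uniform_def)
    then show "\<exists>T. vertex_cover V E T \<and> card T = r" by blast
  next
    fix k assume "\<exists>T. vertex_cover V E T \<and> card T = k"
    then obtain T where T: "vertex_cover V E T" "card T = k" by blast
    show "r \<le> k"
    proof (rule ccontr)
      assume "\<not> r \<le> k"
      then obtain e where "e \<in> E" "e \<inter> T = {}"
        using no_cover[of T] T by (auto simp: vertex_cover_def)
      then show False using T(1) by (auto simp: vertex_cover_def)
    qed
  qed
  then show ?thesis using V E by (simp add: admissible_def hypergraph_def)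
qed

lemma admissible_avoiding_edge:
  assumes "admissible n r V E" "T \<subseteq> V" "card T < r"
  shows "\<exists>e\<in>E. e \<inter> T = {}"
proof -
  have "\<not> vertex_cover V E T"
    using cover_number_le[of V E T] assms by (auto simp: admissible_def)
  then show ?thesis using assms(2) by (auto simp: vertex_cover_def)
qed

lemma admissible_image:
  assumes adm: "admissible n r V E" and f: "inj_on f V" and r: "r \<ge> 1"
  shows "admissible n r (f ` V) ((`) f ` E)"
proof (rule admissibleI)
  have V: "finite V" "card V = n" "\<And>e. e \<in> E \<Longrightarrow> e \<subseteq> V" and E: "uniform r E" "intersecting E"
    using adm by (auto simp: admissible_def hypergraph_def)
  show "finite (f ` V)" "card (f ` V) = n" using V f by (auto simp: card_image)
  show "e' \<subseteq> f ` V" if "e' \<in> (`) f ` E" for e' using that V(3) by blast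
  show "uniform r ((`) f ` E)"
    using E(1) V(3) f by (auto simp: uniform_def card_image inj_on_subset)
  show "intersecting ((`) f ` E)" using E(2) by (fastforce simp: intersecting_def)
  fix T assume T: "T \<subseteq> f ` V" "card T < r"
  define S where "S = {x\<in>V. f x \<in> T}"
  have "T = f ` S" using T(1) by (auto simp: S_def)
  moreover have "inj_on f S" using f by (rule inj_on_subset) (auto simp: S_def)
  ultimately have "card S < r" using T(2) by (simp add: card_image)
  then obtain e where "e \<in> E" "e \<inter> S = {}"
    using admissible_avoiding_edge[OF adm, of S] by (auto simp: S_def)
  then show "\<exists>e'\<in>(`) f ` E. e' \<inter> T = {}"
    using V(3) by (intro bexI[of _ "f ` e"]) (auto simp: S_def)
qed (fact r)

lemma admissible_add_vertices:
  assumes adm: "admissible n r V E" and W: "finite W" "V \<subseteq> W" and r: "r \<ge> 1"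
  shows "admissible (card W) r W E"
proof (rule admissibleI)
  have V: "finite V" "\<And>e. e \<in> E \<Longrightarrow> e \<subseteq> V" using adm by (auto simp: admissible_def hypergraph_def)
  show "e \<subseteq> W" if "e \<in> E" for e using V(2)[OF that] W(2) by simp
  show "uniform r E" "intersecting E" using adm by (auto simp: admissible_def)
  fix T assume T: "T \<subseteq> W" "card T < r"
  have "card (T \<inter> V) \<le> card T" using T(1) W(1) by (meson card_mono finite_subset inf_le1)
  then obtain e where "e \<in> E" "e \<inter> (T \<inter> V) = {}"
    using admissible_avoiding_edge[OF adm, of "T \<inter> V"] T(2) by auto
  then show "\<exists>e\<in>E. e \<inter> T = {}" using V(2) by blast
qed (use W r in auto)

lemma min_edges_attained:
  assumes "r \<ge> 1" "n \<ge> 2 * r - 1"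
  shows "\<exists>(V :: nat set) E. admissible n r V E \<and> card E = min_edges n r"
  unfolding min_edges_def
  by (rule LeastI_ex) (use admissible_exists[OF assms] in blast)

lemma min_edges_le_card:
  fixes V :: "'v set"
  assumes adm: "admissible m r V E" and m: "m \<le> n" and r: "r \<ge> 1"
  shows "min_edges n r \<le> card E"
proof -
  have V: "finite V" "card V = m" and E: "finite E"
    using adm finite_edges by (auto simp: admissible_def hypergraph_def)
  obtain f :: "'v \<Rightarrow> nat" where f: "inj_on f V" "f ` V \<subseteq> {..<n}"
    using card_le_inj[OF V(1), of "{..<n}"] V(2) m by auto
  have "admissible (card {..<n}) r {..<n} ((`) f ` E)"
    using admissible_add_vertices[OF admissible_image[OF adm f(1) r] _ f(2) r] by simp
  then have "min_edges n r \<le> card ((`) f ` E)"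
    unfolding min_edges_def card_lessThan by (intro Least_le) blast
  also have "\<dots> \<le> card E" using E by (rule card_image_le)
  finally show ?thesis .
qed

lemma min_edges_antimono:
  assumes "r \<ge> 1" "2 * r - 1 \<le> m" "m \<le> n"
  shows "min_edges n r \<le> min_edges m r"
proof -
  obtain V :: "nat set" and E where "admissible m r V E" "card E = min_edges m r"
    using min_edges_attained[OF assms(1,2)] by blast
  then show ?thesis using min_edges_le_card[OF _ assms(3,1)] by metis
qed

lemma min_edges_le_two_power:
  assumes "r \<ge> 1" "2 * r - 1 \<le> n"
  shows "min_edges n r \<le> 2 ^ (2 * r - 1)"
proof -
  obtain V :: "nat set" and E where VE: "admissible (2 * r - 1) r V E"
    using admissible_exists[OF assms(1) order.refl] by blast
  then have "finite V" "card V = 2 * r - 1" "E \<subseteq> Pow V"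
    by (auto simp: admissible_def hypergraph_def)
  then have "card E \<le> 2 ^ (2 * r - 1)"
    by (metis card_Pow card_mono finite_Pow_iff)
  then show ?thesis using min_edges_le_card[OF VE assms(2,1)] by simp
qed

lemma min_edges_ge_powr:
  assumes "r \<ge> 2" "2 * r - 1 \<le> n"
  shows "2 powr (1 / 2 * (real r)\<^sup>2 / real n) \<le> min_edges n r"
proof -
  obtain V :: "nat set" and E where VE: "admissible n r V E" "card E = min_edges n r"
    using min_edges_attained[of r n] assms by auto
  have "2 powr (1 / 2 * (real r)\<^sup>2 / real n) \<le> exp (1 / 2 * (real r)\<^sup>2 / real n)"
    using ln_2_less_1 by (simp add: powr_def mult_left_le divide_right_mono)
  also have "\<dots> \<le> exp (real r * real (r - 1) / real n)"
  proof -
    have "real r * (real r / 2) \<le> real r * real (r - 1)"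
      using assms(1) by (intro mult_left_mono) (auto simp: of_nat_diff)
    then have "real r * (real r / 2) / real n \<le> real r * real (r - 1) / real n"
      by (intro divide_right_mono) auto
    then show ?thesis by (simp add: power2_eq_square)
  qed
  also have "\<dots> \<le> min_edges n r"
    using card_edges_ge_exp[of V E r "r - 1"] VE assms(1) by (auto simp: admissible_def)
  finally show ?thesis .
qed

section \<open>Hypergraphs sampled from profiles\<close>

definition profile_edges :: "'i set \<Rightarrow> ('i \<Rightarrow> 'v set) \<Rightarrow> ('i \<Rightarrow> nat) \<Rightarrow> 'v set set" where
  "profile_edges I A d = {e. e \<subseteq> (\<Union>a\<in>I. A a) \<and> (\<forall>a\<in>I. card (e \<inter> A a) = d a)}"

lemma finite_profile_edges:
  assumes "finite I" "\<And>a. a \<in> I \<Longrightarrow> finite (A a)"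
  shows "finite (profile_edges I A d)"
proof (rule finite_subset)
  show "profile_edges I A d \<subseteq> Pow (\<Union>a\<in>I. A a)" by (auto simp: profile_edges_def)
  show "finite (Pow (\<Union>a\<in>I. A a))" using assms by simp
qed

lemma card_profile_edge:
  assumes "finite I" "\<And>a. a \<in> I \<Longrightarrow> finite (A a)" "disjoint_family_on A I"
    and e: "e \<in> profile_edges I A d"
  shows "card e = (\<Sum>a\<in>I. d a)"
proof -
  have "e = (\<Union>a\<in>I. e \<inter> A a)" using e by (auto simp: profile_edges_def)
  also have "card \<dots> = (\<Sum>a\<in>I. card (e \<inter> A a))"
    using assms by (intro card_UN_disjoint) (auto simp: disjoint_family_on_def)
  also have "\<dots> = (\<Sum>a\<in>I. d a)" using e by (intro sum.cong) (auto simp: profile_edges_def)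
  finally show ?thesis .
qed

lemma profile_edges_meet:
  assumes e: "e \<in> profile_edges I A d" "e' \<in> profile_edges I A d'"
    and a: "a \<in> I" "finite (A a)" "card (A a) < d a + d' a"
  shows "e \<inter> e' \<noteq> {}"
proof
  assume "e \<inter> e' = {}"
  then have "card (e \<inter> A a) + card (e' \<inter> A a) = card ((e \<inter> A a) \<union> (e' \<inter> A a))"
    using a(2) by (intro card_Un_disjoint[symmetric]) auto
  also have "\<dots> \<le> card (A a)" using a(2) by (intro card_mono) auto
  finally show False using e a by (simp add: profile_edges_def)
qed

lemma UN_Int_disjoint_family:
  assumes disj: "disjoint_family_on A I" and sub: "\<And>i. i \<in> I \<Longrightarrow> B i \<subseteq> A i" and j: "j \<in> I"
  shows "(\<Union>i\<in>I. B i) \<inter> A j = B j"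
proof
  show "B j \<subseteq> (\<Union>i\<in>I. B i) \<inter> A j" using sub[OF j] j by blast
  show "(\<Union>i\<in>I. B i) \<inter> A j \<subseteq> B j"
  proof
    fix x assume "x \<in> (\<Union>i\<in>I. B i) \<inter> A j"
    then obtain i where i: "i \<in> I" "x \<in> B i" "x \<in> A j" by blast
    then have "A i \<inter> A j \<noteq> {}" using sub by blast
    then have "i = j" using disjoint_family_onD[OF disj i(1) j] by blast
    then show "x \<in> B j" using i by simp
  qed
qed

lemma card_profile_edges:
  assumes "finite I" "\<And>a. a \<in> I \<Longrightarrow> finite (A a)" and disj: "disjoint_family_on A I"
  shows "card (profile_edges I A d) = (\<Prod>a\<in>I. card (A a) choose d a)"
proof -
  let ?choices = "\<Pi>\<^sub>E a\<in>I. {Y. Y \<subseteq> A a \<and> card Y = d a}"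
  have choice: "f a \<subseteq> A a" "card (f a) = d a" if "f \<in> ?choices" "a \<in> I" for f a
    using PiE_mem[OF that] by simp_all
  have union_Int: "(\<Union>a'\<in>I. f a') \<inter> A a = f a" if "f \<in> ?choices" "a \<in> I" for f a
    using UN_Int_disjoint_family[OF disj choice(1)[OF that(1)] that(2)] .
  have "bij_betw (\<lambda>f. \<Union>a\<in>I. f a) ?choices (profile_edges I A d)"
  proof (rule bij_betw_byWitness[where f' = "\<lambda>e. \<lambda>a\<in>I. e \<inter> A a"])
    show "\<forall>f\<in>?choices. (\<lambda>a\<in>I. (\<Union>a'\<in>I. f a') \<inter> A a) = f"
    proof
      fix f assume f: "f \<in> ?choices"
      then have "(\<lambda>a\<in>I. (\<Union>a'\<in>I. f a') \<inter> A a) = restrict f I"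
        by (intro restrict_ext union_Int)
      then show "(\<lambda>a\<in>I. (\<Union>a'\<in>I. f a') \<inter> A a) = f" using PiE_restrict[OF f] by simp
    qed
    show "\<forall>e\<in>profile_edges I A d. (\<Union>a\<in>I. (\<lambda>a\<in>I. e \<inter> A a) a) = e"
      by (auto simp: profile_edges_def)
    show "(\<lambda>f. \<Union>a\<in>I. f a) ` ?choices \<subseteq> profile_edges I A d"
    proof (rule image_subsetI)
      fix f assume f: "f \<in> ?choices"
      have "(\<Union>a\<in>I. f a) \<subseteq> (\<Union>a\<in>I. A a)" using choice(1)[OF f] by blast
      then show "(\<Union>a\<in>I. f a) \<in> profile_edges I A d"
        using union_Int[OF f] choice(2)[OF f] unfolding profile_edges_def by simp
    qed
    show "(\<lambda>e. \<lambda>a\<in>I. e \<inter> A a) ` profile_edges I A d \<subseteq> ?choices"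
      by (auto simp: profile_edges_def)
  qed
  then have "card (profile_edges I A d) = card ?choices"
    by (rule bij_betw_same_card[symmetric])
  also have "\<dots> = (\<Prod>a\<in>I. card (A a) choose d a)"
    using assms by (simp add: card_PiE n_subsets)
  finally show ?thesis .
qed

text \<open>The probability that a random edge of profile \<open>d\<close>, in blocks of sizes \<open>b a\<close>, misses a fixed
  set that has \<open>w a\<close> vertices in block \<open>a\<close>.\<close>

definition miss_probability :: "'i set \<Rightarrow> ('i \<Rightarrow> nat) \<Rightarrow> ('i \<Rightarrow> nat) \<Rightarrow> ('i \<Rightarrow> nat) \<Rightarrow> real" where
  "miss_probability I b d w =
    (\<Prod>a\<in>I. real (b a - w a choose d a) / real (b a choose d a))"

lemma profile_edges_avoiding:
  "{e\<in>profile_edges I A d. e \<inter> T = {}} = profile_edges I (\<lambda>a. A a - T) d"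
proof (intro Set.set_eqI iffI)
  fix e assume "e \<in> {e\<in>profile_edges I A d. e \<inter> T = {}}"
  moreover from this have "e \<inter> (A a - T) = e \<inter> A a" for a by blast
  ultimately show "e \<in> profile_edges I (\<lambda>a. A a - T) d" by (auto simp: profile_edges_def)
next
  fix e assume e: "e \<in> profile_edges I (\<lambda>a. A a - T) d"
  then have "e \<inter> T = {}" by (auto simp: profile_edges_def)
  moreover from this have "e \<inter> (A a - T) = e \<inter> A a" for a by blast
  ultimately show "e \<in> {e\<in>profile_edges I A d. e \<inter> T = {}}"
    using e by (auto simp: profile_edges_def)
qed

lemma card_profile_edges_avoiding:
  assumes I: "finite I" "\<And>a. a \<in> I \<Longrightarrow> finite (A a)" and disj: "disjoint_family_on A I"
  shows "card {e\<in>profile_edges I A d. e \<inter> T = {}}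
    = miss_probability I (\<lambda>a. card (A a)) d (\<lambda>a. card (T \<inter> A a)) * card (profile_edges I A d)"
proof -
  have "disjoint_family_on (\<lambda>a. A a - T) I"
    using disj by (rule disjoint_family_on_bisimulation) blast
  moreover have "card (A a - T) = card (A a) - card (T \<inter> A a)" if "a \<in> I" for a
    using I(2)[OF that] by (metis Int_commute card_Diff_subset_Int finite_Int)
  ultimately have avoiding: "card {e\<in>profile_edges I A d. e \<inter> T = {}}
      = (\<Prod>a\<in>I. card (A a) - card (T \<inter> A a) choose d a)"
    using I by (simp add: profile_edges_avoiding card_profile_edges)
  have "card {e\<in>profile_edges I A d. e \<inter> T = {}} \<le> card (profile_edges I A d)"
    using I by (intro card_mono finite_profile_edges) auto
  then show ?thesis
    unfolding avoiding miss_probability_def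
    by (cases "card (profile_edges I A d) = 0")
      (simp_all add: prod_dividef card_profile_edges[OF I disj] flip: of_nat_prod)
qed

lemma ex_profile_edges_avoiding:
  fixes I :: "'i set" and A :: "'i \<Rightarrow> 'v set" and d :: "'i \<Rightarrow> nat"
  defines "V \<equiv> (\<Union>a\<in>I. A a)"
    and "miss \<equiv> \<lambda>T. miss_probability I (\<lambda>a. card (A a)) d (\<lambda>a. card (T \<inter> A a))"
  assumes I: "finite I" "\<And>a. a \<in> I \<Longrightarrow> finite (A a)" and disj: "disjoint_family_on A I"
    and p: "0 < p" and k: "2 ^ card V < exp (p * real k)"
  shows "\<exists>Y\<subseteq>profile_edges I A d. card Y \<le> k \<and>
    (\<forall>T\<subseteq>V. p \<le> miss T \<longrightarrow> (\<exists>e\<in>Y. e \<inter> T = {}))"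
proof (cases "\<exists>T\<subseteq>V. p \<le> miss T")
  case False
  then show ?thesis by (intro exI[of _ "{}"]) auto
next
  case True
  let ?\<T> = "{T. T \<subseteq> V \<and> p \<le> miss T}"
  let ?missing = "\<lambda>T. {e\<in>profile_edges I A d. e \<inter> T = {}}"
  have finV: "finite V" using I by (simp add: V_def)
  have finE: "finite (profile_edges I A d)" using I by (rule finite_profile_edges)
  obtain T where "p \<le> miss T" using True by blast
  then have "miss T \<noteq> 0" using p by linarith
  then have "card (profile_edges I A d) \<noteq> 0"
    using I by (auto simp: miss_def miss_probability_def card_profile_edges[OF I disj])
  then have E_ne: "profile_edges I A d \<noteq> {}" by auto
  have few: "card ?\<T> < exp (p * real k)"
  proof -
    have "card ?\<T> \<le> card (Pow V)" using finV by (intro card_mono) auto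
    then have "card ?\<T> \<le> 2 ^ card V" using finV by (simp add: card_Pow)
    then have "real (card ?\<T>) \<le> real (2 ^ card V)" by (rule of_nat_mono)
    also have "\<dots> < exp (p * real k)" using k by simp
    finally show ?thesis .
  qed
  have "\<exists>Y\<subseteq>profile_edges I A d. card Y \<le> k \<and> (\<forall>T\<in>?\<T>. ?missing T \<inter> Y \<noteq> {})"
  proof (rule ex_small_hitting_set[OF finE E_ne _ _ _ few])
    show "finite ?\<T>" using finV by simp
    show "?missing T \<subseteq> profile_edges I A d" for T by blast
    fix T assume "T \<in> ?\<T>"
    then have "p * card (profile_edges I A d) \<le> miss T * card (profile_edges I A d)"
      by (intro mult_right_mono) auto
    also have "\<dots> = card (?missing T)"
      unfolding miss_def by (rule card_profile_edges_avoiding[OF I disj, symmetric])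
    finally show "p * card (profile_edges I A d) \<le> card (?missing T)" .
  qed
  then obtain Y where Y: "Y \<subseteq> profile_edges I A d" "card Y \<le> k"
    "\<And>T. T \<subseteq> V \<Longrightarrow> p \<le> miss T \<Longrightarrow> ?missing T \<inter> Y \<noteq> {}"
    by auto
  moreover have "\<exists>e\<in>Y. e \<inter> T = {}" if "T \<subseteq> V" "p \<le> miss T" for T
    using Y(3)[OF that] by blast
  ultimately show ?thesis by blast
qed

locale intersecting_profiles =
  fixes r :: nat and I :: "'i set" and b :: "'i \<Rightarrow> nat" and D :: "('i \<Rightarrow> nat) set"
  assumes finite_blocks: "finite I" and finite_profiles: "finite D"
    and sum_profile: "d \<in> D \<Longrightarrow> (\<Sum>a\<in>I. d a) = r"
    and profiles_meet: "d \<in> D \<Longrightarrow> d' \<in> D \<Longrightarrow> \<exists>a\<in>I. b a < d a + d' a"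
begin

lemma admissible_profile_edges:
  assumes A: "\<And>a. finite (A a)" "\<And>a. card (A a) = b a" "disjoint_family_on A I" and r: "r \<ge> 1"
    and E: "E \<subseteq> (\<Union>d\<in>D. profile_edges I A d)"
    and no_cover: "\<And>T. T \<subseteq> (\<Union>a\<in>I. A a) \<Longrightarrow> (\<Sum>a\<in>I. card (T \<inter> A a)) < r \<Longrightarrow>
      \<exists>e\<in>E. e \<inter> T = {}"
  shows "admissible (\<Sum>a\<in>I. b a) r (\<Union>a\<in>I. A a) E"
proof (rule admissibleI)
  show "finite (\<Union>a\<in>I. A a)" "card (\<Union>a\<in>I. A a) = (\<Sum>a\<in>I. b a)"
    using finite_blocks A by (auto simp: card_UN_disjoint disjoint_family_on_def)
  show "e \<subseteq> (\<Union>a\<in>I. A a)" if "e \<in> E" for e using that E by (auto simp: profile_edges_def)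
  show "uniform r E"
    unfolding uniform_def
  proof
    fix e assume "e \<in> E"
    then obtain d where "d \<in> D" "e \<in> profile_edges I A d" using E by blast
    then show "card e = r"
      using card_profile_edge[OF finite_blocks A(1,3)] sum_profile by simp
  qed
  show "intersecting E"
    unfolding intersecting_def
  proof (intro ballI)
    fix e e' assume "e \<in> E" "e' \<in> E"
    then obtain d d' where "d \<in> D" "e \<in> profile_edges I A d" "d' \<in> D" "e' \<in> profile_edges I A d'"
      using E by blast
    moreover from this obtain a where "a \<in> I" "b a < d a + d' a" using profiles_meet by blast
    ultimately show "e \<inter> e' \<noteq> {}" using profile_edges_meet A by metis
  qed
  fix T assume T: "T \<subseteq> (\<Union>a\<in>I. A a)" "card T < r"
  have "T \<in> profile_edges I A (\<lambda>a. card (T \<inter> A a))" using T(1) by (simp add: profile_edges_def)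
  then have "card T = (\<Sum>a\<in>I. card (T \<inter> A a))"
    by (rule card_profile_edge[OF finite_blocks A(1,3)])
  then show "\<exists>e\<in>E. e \<inter> T = {}" using no_cover T by simp
qed (fact r)

lemma min_edges_le_sample:
  assumes r: "r \<ge> 1" and n: "(\<Sum>a\<in>I. b a) \<le> n"
    and miss: "\<And>w. (\<And>a. a \<in> I \<Longrightarrow> w a \<le> b a) \<Longrightarrow> (\<Sum>a\<in>I. w a) < r \<Longrightarrow>
      \<exists>d\<in>D. p \<le> miss_probability I b d w"
    and p: "0 < p" and k: "2 ^ (\<Sum>a\<in>I. b a) < exp (p * real k)"
  shows "min_edges n r \<le> card D * k"
proof -
  define A where "A a = {a} \<times> {..<b a}" for a
  define V where "V = (\<Union>a\<in>I. A a)"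
  have A: "finite (A a)" "card (A a) = b a" for a by (auto simp: A_def card_cartesian_product)
  have disj: "disjoint_family_on A I" by (auto simp: disjoint_family_on_def A_def)
  have card_V: "card V = (\<Sum>a\<in>I. b a)"
    using finite_blocks A disj by (auto simp: V_def card_UN_disjoint disjoint_family_on_def)
  have "\<exists>Y\<subseteq>profile_edges I A d. card Y \<le> k \<and> (\<forall>T\<subseteq>V.
      p \<le> miss_probability I b d (\<lambda>a. card (T \<inter> A a)) \<longrightarrow> (\<exists>e\<in>Y. e \<inter> T = {}))" for d
    using ex_profile_edges_avoiding[OF finite_blocks A(1) disj p, of k d] k card_V
    by (simp add: A(2) V_def)
  then obtain Y where Y: "Y d \<subseteq> profile_edges I A d" "card (Y d) \<le> k"
    "T \<subseteq> V \<Longrightarrow> p \<le> miss_probability I b d (\<lambda>a. card (T \<inter> A a)) \<Longrightarrow> \<exists>e\<in>Y d. e \<inter> T = {}" for d T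
    by metis
  have "admissible (\<Sum>a\<in>I. b a) r (\<Union>a\<in>I. A a) (\<Union>d\<in>D. Y d)"
  proof (rule admissible_profile_edges[OF A disj r])
    show "(\<Union>d\<in>D. Y d) \<subseteq> (\<Union>d\<in>D. profile_edges I A d)" using Y(1) by blast
    fix T assume T: "T \<subseteq> (\<Union>a\<in>I. A a)" "(\<Sum>a\<in>I. card (T \<inter> A a)) < r"
    have "card (T \<inter> A a) \<le> b a" for a
      using card_mono[OF A(1), of "T \<inter> A a" a] A(2) by simp
    then obtain d where d: "d \<in> D" "p \<le> miss_probability I b d (\<lambda>a. card (T \<inter> A a))"
      using miss T(2) by meson
    then obtain e where "e \<in> Y d" "e \<inter> T = {}" using Y(3)[of T d] T(1) by (auto simp: V_def)
    then show "\<exists>e\<in>\<Union>d\<in>D. Y d. e \<inter> T = {}" using d(1) by blast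
  qed
  then have "min_edges n r \<le> card (\<Union>d\<in>D. Y d)" using n r by (rule min_edges_le_card)
  also have "\<dots> \<le> (\<Sum>d\<in>D. card (Y d))" using finite_profiles by (rule card_UN_le)
  also have "\<dots> \<le> card D * k" using Y(2) sum_bounded_above[of D "\<lambda>d. card (Y d)" k] by simp
  finally show ?thesis .
qed

end

section \<open>Finite fields inside an algebraically closed field\<close>

lemma rsquarefreeI_pderiv:
  fixes p :: "'a :: idom poly"
  assumes "p \<noteq> 0" and simple: "\<And>a. poly p a = 0 \<Longrightarrow> poly (pderiv p) a \<noteq> 0"
  shows "rsquarefree p"
  unfolding rsquarefree_def
proof (intro conjI allI)
  fix a
  have "\<not> 2 \<le> order a p"
  proof
    assume "2 \<le> order a p"
    then have "[:-a, 1:] ^ 2 dvd p" using assms(1) by (simp add: order_divides)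
    then obtain g where "p = [:-a, 1:] ^ 2 * g" by (elim dvdE)
    then have "p = [:-a, 1:] * ([:-a, 1:] * g)" by (simp only: power2_eq_square mult.assoc)
    then have "poly p a = 0" "poly (pderiv p) a = 0"
      by (simp_all add: pderiv_mult del: mult_pCons_left mult_pCons_right)
    then show False using simple by blast
  qed
  then show "order a p = 0 \<or> order a p = 1" by linarith
qed (fact assms(1))

lemma size_proots_alg_closed:
  fixes p :: "'a :: alg_closed_field poly"
  shows "size (proots p) = degree p"
proof (cases "p = 0")
  case False
  then obtain A where A: "size A = degree p" "p = smult (lead_coeff p) (\<Prod>x\<in>#A. [:-x, 1:])"
    using alg_closed_imp_factorization by blast
  have "proots (\<Prod>x\<in>#A. [:-x, 1:]) = A"
  proof (induction A)
    case (add x A)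
    have "(\<Prod>x\<in>#A. [:-x, 1:]) \<noteq> 0" by (auto simp: prod_mset_zero_iff)
    then have "proots ([:-x, 1:] * (\<Prod>x\<in>#A. [:-x, 1:])) = add_mset x A"
      using add by (subst proots_mult) auto
    then show ?case by simp
  qed simp
  then show ?thesis using A False by (metis leading_coeff_0_iff proots_smult)
qed simp

lemma card_roots_rsquarefree:
  fixes p :: "'a :: alg_closed_field poly"
  assumes "rsquarefree p"
  shows "card {x. poly p x = 0} = degree p"
proof -
  have p: "p \<noteq> 0" using assms by (simp add: rsquarefree_def)
  have "card {x. poly p x = 0} = (\<Sum>x | poly p x = 0. order x p)"
    using rsquarefree_root_order[OF assms _ p] by simp
  also have "\<dots> = size (proots p)" using p by (simp add: size_multiset_overloaded_eq)
  finally show ?thesis by (simp add: size_proots_alg_closed)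
qed

definition frobenius_fixed :: "nat \<Rightarrow> 'a :: field set" where
  "frobenius_fixed k = {x. x ^ CHAR('a) ^ k = x}"

lemma card_frobenius_fixed:
  assumes char: "prime CHAR('a :: alg_closed_field)" and k: "k \<ge> 1"
  shows "card (frobenius_fixed k :: 'a set) = CHAR('a) ^ k"
proof -
  define q where "q = CHAR('a) ^ k"
  define p :: "'a poly" where "p = monom 1 q - monom 1 1"
  have "CHAR('a) ^ 1 \<le> q"
    unfolding q_def using char k by (intro power_increasing) (auto simp: prime_gt_0_nat Suc_le_eq)
  then have q: "q > 1" using prime_gt_1_nat[OF char] by simp
  have deg: "degree p = q"
    unfolding p_def diff_conv_add_uminus using q
    by (subst degree_add_eq_left) (auto simp: degree_monom_eq)
  have "of_nat q = (0 :: 'a)" unfolding q_def using k by simp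
  then have "pderiv p = - 1" by (simp add: p_def pderiv_diff pderiv_monom)
  then have "rsquarefree p" using deg q by (intro rsquarefreeI_pderiv) auto
  then have "card {x. poly p x = 0} = q" using card_roots_rsquarefree deg by metis
  moreover have "{x. poly p x = 0} = frobenius_fixed k"
    by (auto simp: p_def frobenius_fixed_def q_def poly_monom)
  ultimately show ?thesis by (simp add: q_def)
qed

locale finite_subfield =
  fixes F :: "'a :: field set"
  assumes finite_carrier: "finite F"
    and diff_closed: "x \<in> F \<Longrightarrow> y \<in> F \<Longrightarrow> x - y \<in> F"
    and mult_closed: "x \<in> F \<Longrightarrow> y \<in> F \<Longrightarrow> x * y \<in> F"
    and divide_closed: "x \<in> F \<Longrightarrow> y \<in> F \<Longrightarrow> x / y \<in> F"

lemma finite_subfield_frobenius_fixed: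
  assumes char: "prime CHAR('a :: alg_closed_field)" and k: "k \<ge> 1"
  shows "finite_subfield (frobenius_fixed k :: 'a set)"
proof
  have "card (frobenius_fixed k :: 'a set) > 0"
    using card_frobenius_fixed[OF assms] prime_gt_0_nat[OF char] by simp
  then show "finite (frobenius_fixed k :: 'a set)" by (rule card_ge_0_finite)
  fix x y :: 'a
  assume "x \<in> frobenius_fixed k" "y \<in> frobenius_fixed k"
  then have x: "x ^ CHAR('a) ^ k = x" and y: "y ^ CHAR('a) ^ k = y"
    by (simp_all add: frobenius_fixed_def)
  have "x = (x - y) ^ CHAR('a) ^ k + y"
    using freshmans_dream'[OF char refl, of "x - y" y k] x y by simp
  then show "x - y \<in> frobenius_fixed k" unfolding frobenius_fixed_def by (simp add: eq_diff_eq)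
  show "x * y \<in> frobenius_fixed k" "x / y \<in> frobenius_fixed k"
    by (simp_all add: frobenius_fixed_def power_mult_distrib power_divide x y)
qed

section \<open>Projective planes with a polarity\<close>

text \<open>The polarity names a line by its pole, so \<open>inc x y\<close> says that the point \<open>x\<close> lies on the
  line with pole \<open>y\<close>.\<close>

locale polar_plane =
  fixes q :: nat and P :: "'p set" and inc :: "'p \<Rightarrow> 'p \<Rightarrow> bool"
  assumes finite_points: "finite P"
    and card_points: "card P = q\<^sup>2 + q + 1"
    and inc_sym: "x \<in> P \<Longrightarrow> y \<in> P \<Longrightarrow> inc x y \<Longrightarrow> inc y x"
    and card_lines_through: "x \<in> P \<Longrightarrow> card {y\<in>P. inc x y} = q + 1"
    and ex_joining_line: "x \<in> P \<Longrightarrow> y \<in> P \<Longrightarrow> \<exists>z\<in>P. inc x z \<and> inc y z"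

datatype 'a projective_point = Affine 'a 'a | Slope 'a | Infinity

text \<open>The line with pole \<open>Affine m b\<close> is \<open>y = m * x - b\<close> and the line with pole \<open>Slope a\<close>
  is \<open>x = a\<close>; the minus sign makes the relation symmetric.\<close>

fun incident :: "'a :: field projective_point \<Rightarrow> 'a projective_point \<Rightarrow> bool" where
  "incident (Affine x y) (Affine m b) \<longleftrightarrow> y + b = m * x"
| "incident (Affine x y) (Slope a) \<longleftrightarrow> x = a"
| "incident (Slope a) (Affine x y) \<longleftrightarrow> x = a"
| "incident (Slope a) Infinity \<longleftrightarrow> True"
| "incident Infinity (Slope a) \<longleftrightarrow> True"
| "incident Infinity Infinity \<longleftrightarrow> True"
| "incident _ _ \<longleftrightarrow> False"

lemma incident_commute: "incident u v \<longleftrightarrow> incident v u"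
  by (cases u; cases v) (auto simp: algebra_simps)

context finite_subfield
begin

definition points :: "'a projective_point set" where
  "points = case_prod Affine ` (F \<times> F) \<union> Slope ` F \<union> {Infinity}"

lemma points_simps [simp]:
  "Affine x y \<in> points \<longleftrightarrow> x \<in> F \<and> y \<in> F" "Slope x \<in> points \<longleftrightarrow> x \<in> F" "Infinity \<in> points"
  by (auto simp: points_def)

lemma finite_points: "finite points"
  using finite_carrier by (simp add: points_def)

lemma card_points: "card points = (card F)\<^sup>2 + card F + 1"
proof -
  have "inj_on (case_prod (Affine :: 'a \<Rightarrow> _)) (F \<times> F)" by (auto simp: inj_on_def)
  then have affine: "card (case_prod Affine ` (F \<times> F)) = (card F)\<^sup>2"
    by (simp add: card_image card_cartesian_product power2_eq_square)
  have slopes: "card (Slope ` F) = card F" by (simp add: card_image inj_on_def)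
  have "card (case_prod Affine ` (F \<times> F) \<union> Slope ` F) = (card F)\<^sup>2 + card F"
    using finite_carrier affine slopes by (subst card_Un_disjoint) auto
  then show ?thesis
    unfolding points_def using finite_carrier by (subst card_Un_disjoint) auto
qed

lemma lines_through_Affine:
  assumes "x \<in> F" "y \<in> F"
  shows "{v\<in>points. incident (Affine x y) v} = insert (Slope x) ((\<lambda>m. Affine m (m * x - y)) ` F)"
proof (intro Set.set_eqI)
  fix v
  show "v \<in> {v\<in>points. incident (Affine x y) v} \<longleftrightarrow>
      v \<in> insert (Slope x) ((\<lambda>m. Affine m (m * x - y)) ` F)"
  proof (cases v)
    case (Affine m b)
    have "y + b = m * x \<longleftrightarrow> b = m * x - y" by (auto simp: algebra_simps)
    then show ?thesis using assms mult_closed diff_closed Affine by auto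
  qed (use assms in auto)
qed

lemma card_lines_through:
  assumes "u \<in> points"
  shows "card {v\<in>points. incident u v} = card F + 1"
proof (cases u)
  case (Affine x y)
  have "{v\<in>points. incident u v} = insert (Slope x) ((\<lambda>m. Affine m (m * x - y)) ` F)"
    unfolding Affine by (rule lines_through_Affine) (use assms Affine in simp_all)
  moreover have "card ((\<lambda>m. Affine m (m * x - y)) ` F) = card F"
    by (simp add: card_image inj_on_def)
  moreover have "Slope x \<notin> (\<lambda>m. Affine m (m * x - y)) ` F" by auto
  ultimately show ?thesis using finite_carrier by simp
next
  case (Slope a)
  then have "{v\<in>points. incident u v} = insert Infinity (Affine a ` F)"
    using assms by (auto simp: points_def)
  moreover have "card (Affine a ` F) = card F" by (simp add: card_image inj_on_def)
  moreover have "Infinity \<notin> Affine a ` F" by auto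
  ultimately show ?thesis using finite_carrier by simp
next
  case Infinity
  then have "{v\<in>points. incident u v} = insert Infinity (Slope ` F)" by (auto simp: points_def)
  moreover have "card (Slope ` F) = card F" by (simp add: card_image inj_on_def)
  moreover have "Infinity \<notin> Slope ` F" by auto
  ultimately show ?thesis using finite_carrier by simp
qed

lemma ex_line_through_Affine_Affine:
  assumes F: "x \<in> F" "y \<in> F" "x' \<in> F" "y' \<in> F"
  shows "\<exists>z\<in>points. incident (Affine x y) z \<and> incident (Affine x' y') z"
proof (cases "x = x'")
  case True
  then show ?thesis using F by (intro bexI[of _ "Slope x"]) auto
next
  case False
  define m where "m = (y - y') / (x - x')"
  have "m * (x - x') = y - y'" using False by (simp add: m_def)
  then have "incident (Affine x y) (Affine m (m * x - y))"
    "incident (Affine x' y') (Affine m (m * x - y))"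
    by (auto simp: algebra_simps)
  moreover have "m \<in> F" unfolding m_def by (intro divide_closed diff_closed F)
  then have "Affine m (m * x - y) \<in> points" using F by (simp add: diff_closed mult_closed)
  ultimately show ?thesis by blast
qed

lemma ex_joining_line:
  assumes "u \<in> points" "v \<in> points"
  shows "\<exists>z\<in>points. incident u z \<and> incident v z"
proof (cases u)
  case u: (Affine x y)
  show ?thesis
  proof (cases v)
    case (Affine x' y')
    then show ?thesis using assms u ex_line_through_Affine_Affine by simp
  next
    case (Slope a)
    then show ?thesis
      using assms u diff_closed mult_closed by (intro bexI[of _ "Affine a (a * x - y)"]) auto
  next
    case Infinity
    then show ?thesis using assms u by (intro bexI[of _ "Slope x"]) auto
  qed
next
  case u: (Slope a)
  show ?thesis
  proof (cases v)
    case (Affine x y)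
    then show ?thesis
      using assms u diff_closed mult_closed by (intro bexI[of _ "Affine a (a * x - y)"]) auto
  qed (use u in \<open>auto intro: bexI[of _ Infinity]\<close>)
next
  case u: Infinity
  show ?thesis
  proof (cases v)
    case (Affine x y)
    then show ?thesis using assms u by (intro bexI[of _ "Slope x"]) auto
  qed (use u in \<open>auto intro: bexI[of _ Infinity]\<close>)
qed

lemma polar_plane_points: "polar_plane (card F) points incident"
  by unfold_locales
    (rule finite_points card_points card_lines_through ex_joining_line incident_commute[THEN iffD1];
      assumption)+

end

lemma CHAR_bit [simp]: "CHAR(bit) = 2"
proof (rule CHAR_eq_posI)
  fix x :: nat assume "0 < x" "x < 2"
  then have "x = 1" by simp
  then show "of_nat x \<noteq> (0 :: bit)" by simp
qed simp_all

lemma ex_polar_plane_two_power: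
  assumes "k \<ge> 1"
  shows "\<exists>P :: bit alg_closure projective_point set. polar_plane (2 ^ k) P incident"
proof -
  have char: "prime CHAR(bit alg_closure)" by simp
  then have "card (frobenius_fixed k :: bit alg_closure set) = 2 ^ k"
    using card_frobenius_fixed assms by fastforce
  then show ?thesis
    using finite_subfield.polar_plane_points[OF finite_subfield_frobenius_fixed[OF char assms]]
    by auto
qed

context polar_plane
begin

definition line :: "'p \<Rightarrow> 'p set" where
  "line y = {x\<in>P. inc x y}"

lemma card_line:
  assumes "y \<in> P"
  shows "card (line y) = q + 1"
proof -
  have "line y = {x\<in>P. inc y x}" using assms inc_sym by (auto simp: line_def)
  then show ?thesis using assms by (simp add: card_lines_through)
qed

lemma card_lines_meeting:
  assumes "A \<subseteq> P"
  shows "card {y\<in>P. line y \<inter> A \<noteq> {}} \<le> q * card A + 1"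
proof -
  have "finite A" using assms finite_points by (rule finite_subset)
  then show ?thesis using assms
  proof (induction A rule: finite_induct)
    case (insert a A)
    let ?meeting = "{y\<in>P. line y \<inter> A \<noteq> {}}" and ?through = "{y\<in>P. inc a y}"
    have through: "card ?through = q + 1" using card_lines_through insert.prems by simp
    have split: "{y\<in>P. line y \<inter> insert a A \<noteq> {}} = ?meeting \<union> (?through - ?meeting)"
      using insert.prems by (auto simp: line_def)
    have meeting_insert:
      "card {y\<in>P. line y \<inter> insert a A \<noteq> {}} \<le> card ?meeting + card (?through - ?meeting)"
      unfolding split by (rule card_Un_le)
    show ?case
    proof (cases "A = {}")
      case True
      then show ?thesis using meeting_insert through by simp
    next
      case False
      then obtain x where "x \<in> A" by blast
      then obtain z where "z \<in> P" "inc a z" "inc x z"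
        using ex_joining_line insert.prems by blast
      then have "?through - ?meeting \<subseteq> ?through - {z}" "z \<in> ?through"
        using \<open>x \<in> A\<close> insert.prems by (auto simp: line_def)
      then have "card (?through - ?meeting) \<le> card (?through - {z})"
        using finite_points by (intro card_mono) auto
      also have "\<dots> = q" using through \<open>z \<in> ?through\<close> by simp
      finally show ?thesis using meeting_insert insert by simp
    qed
  qed simp
qed

lemma card_lines_avoiding:
  assumes "A \<subseteq> P"
  shows "q * (q + 1 - card A) \<le> card {y\<in>P. line y \<inter> A = {}}"
proof -
  have "P = {y\<in>P. line y \<inter> A = {}} \<union> {y\<in>P. line y \<inter> A \<noteq> {}}" by blast
  then have "card P = card ({y\<in>P. line y \<inter> A = {}} \<union> {y\<in>P. line y \<inter> A \<noteq> {}})"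
    by (rule arg_cong)
  also have "\<dots> \<le> card {y\<in>P. line y \<inter> A = {}} + card {y\<in>P. line y \<inter> A \<noteq> {}}"
    by (rule card_Un_le)
  finally have "q * (q + 1) \<le> card {y\<in>P. line y \<inter> A = {}} + q * card A"
    using card_lines_meeting[OF assms] card_points by (simp add: power2_eq_square)
  then show ?thesis by (simp add: diff_mult_distrib2)
qed

lemma sum_line_weights_le:
  fixes w :: "'p \<Rightarrow> nat"
  assumes "U \<subseteq> P" "B \<subseteq> P" and U: "\<And>y. y \<in> U \<Longrightarrow> line y \<subseteq> B"
  shows "(\<Sum>y\<in>U. \<Sum>x\<in>line y. w x) \<le> (q + 1) * (\<Sum>x\<in>B. w x)"
proof -
  have fin: "finite U" "finite B" using assms(1,2) finite_points by (auto intro: finite_subset)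
  have "line y = {x\<in>B. inc x y}" if "y \<in> U" for y using U[OF that] assms(2) by (auto simp: line_def)
  then have "(\<Sum>y\<in>U. \<Sum>x\<in>line y. w x) = (\<Sum>y\<in>U. \<Sum>x\<in>{x\<in>B. inc x y}. w x)"
    by (intro sum.cong refl) simp
  also have "\<dots> = (\<Sum>x\<in>B. \<Sum>y\<in>{y\<in>U. inc x y}. w x)" using fin by (intro sum.swap_restrict)
  also have "\<dots> \<le> (\<Sum>x\<in>B. (q + 1) * w x)"
  proof (rule sum_mono)
    fix x assume "x \<in> B"
    then have "card {y\<in>U. inc x y} \<le> card {y\<in>P. inc x y}" "card {y\<in>P. inc x y} = q + 1"
      using assms(1,2) finite_points card_lines_through by (auto intro!: card_mono)
    then have "card {y\<in>U. inc x y} * w x \<le> (q + 1) * w x" by (intro mult_le_mono1) simp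
    then show "(\<Sum>y\<in>{y\<in>U. inc x y}. w x) \<le> (q + 1) * w x" by simp
  qed
  finally show ?thesis by (simp only: sum_distrib_left)
qed

text \<open>At most \<open>q\<close> points carry weight \<open>s\<close> or more. If they are \<open>q + 1 - d\<close> in number, at least
  \<open>q * d\<close> lines avoid them, which have a total weight below \<open>(q + 1) * d * s\<close> to share, so one of
  them weighs at most \<open>2 * s\<close>.\<close>

lemma ex_light_line:
  fixes w :: "'p \<Rightarrow> nat"
  assumes q: "q \<ge> 1" and w: "(\<Sum>x\<in>P. w x) < (q + 1) * s"
  shows "\<exists>y\<in>P. (\<forall>x\<in>line y. w x < s) \<and> (\<Sum>x\<in>line y. w x) \<le> 2 * s"
proof (rule ccontr)
  assume heavy: "\<not> ?thesis"
  define A where "A = {x\<in>P. s \<le> w x}"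
  define U where "U = {y\<in>P. line y \<inter> A = {}}"
  define deficit where "deficit = q + 1 - card A"
  have A: "A \<subseteq> P" by (auto simp: A_def)
  have "card A * s \<le> (\<Sum>x\<in>A. w x)"
    using sum_bounded_below[of A s w] by (simp add: A_def)
  moreover have "(\<Sum>x\<in>P. w x) = (\<Sum>x\<in>A. w x) + (\<Sum>x\<in>P - A. w x)"
    using sum.subset_diff[OF A finite_points, of w] by simp
  ultimately have weight: "card A * s + (\<Sum>x\<in>P - A. w x) < (q + 1) * s" using w by linarith
  then have "card A * s < (q + 1) * s" by linarith
  then have "card A < q + 1" by (simp only: mult_less_cancel2)
  then have deficit: "deficit \<ge> 1" by (simp add: deficit_def)
  have rest: "(\<Sum>x\<in>P - A. w x) \<le> deficit * s"
    using weight by (simp add: deficit_def diff_mult_distrib)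
  have "2 * s + 1 \<le> (\<Sum>x\<in>line y. w x)" if "y \<in> U" for y
  proof -
    have "\<forall>x\<in>line y. w x < s" using that by (auto simp: U_def A_def line_def not_le)
    then show ?thesis using heavy that by (fastforce simp: U_def not_le)
  qed
  then have "card U * (2 * s + 1) \<le> (\<Sum>y\<in>U. \<Sum>x\<in>line y. w x)"
    using sum_bounded_below[of U "2 * s + 1"] by simp
  also have "\<dots> \<le> (q + 1) * (\<Sum>x\<in>P - A. w x)"
    by (rule sum_line_weights_le) (auto simp: U_def line_def)
  also have "\<dots> \<le> (q + 1) * (deficit * s)" using rest by (rule mult_le_mono2)
  finally have "q * deficit * (2 * s + 1) \<le> (q + 1) * (deficit * s)"
    using card_lines_avoiding[OF A] unfolding U_def deficit_def by (meson le_trans mult_le_mono1)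
  then have "deficit * (q * (2 * s + 1)) \<le> deficit * ((q + 1) * s)" by (simp only: ac_simps)
  then have "q * (2 * s + 1) \<le> (q + 1) * s" using deficit by simp
  moreover have "q * s \<ge> s" using q by simp
  ultimately show False using q by (simp add: algebra_simps)
qed

end

section \<open>Bounds on the probability of missing a set\<close>

lemma binomial_diff_ge:
  fixes \<delta> :: real
  assumes "v \<le> N" "0 \<le> \<delta>" "\<delta> \<le> 1" "real s \<le> (1 - \<delta>) * real (N + 1 - v)"
  shows "\<delta> ^ v * real (N choose s) \<le> real (N - v choose s)"
  using assms(1,4)
proof (induction v)
  case (Suc v)
  define M where "M = N - v"
  have M: "M > 0" "real s \<le> (1 - \<delta>) * real M" using Suc.prems by (auto simp: M_def)
  have "(1 - \<delta>) * real M \<le> (1 - \<delta>) * real (N + 1 - v)"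
    using assms(3) Suc.prems(1) by (intro mult_left_mono) (auto simp: M_def)
  then have IH: "\<delta> ^ v * real (N choose s) \<le> real (M choose s)"
    using Suc.IH Suc.prems(1) M(2) by (simp add: M_def)
  have "(1 - \<delta>) * real M \<le> 1 * real M"
    using assms(2) by (intro mult_right_mono) auto
  then have "s \<le> M" using M(2) by linarith
  then have "\<delta> * real M \<le> real (M - s)" using M(2) by (simp add: of_nat_diff algebra_simps)
  then have "\<delta> * real M * real (M choose s) \<le> real (M - s) * real (M choose s)"
    by (intro mult_right_mono) auto
  also have "\<dots> = real M * real (M - 1 choose s)"
    using binomial_absorb_comp[of M s] by (metis of_nat_mult)
  finally have "\<delta> * real (M choose s) \<le> real (M - 1 choose s)"
    using M(1) by (simp add: mult.assoc mult.left_commute[of \<delta>])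
  moreover have "\<delta> * (\<delta> ^ v * real (N choose s)) \<le> \<delta> * real (M choose s)"
    using IH assms(2) by (rule mult_left_mono)
  moreover have "M - 1 = N - Suc v" by (simp add: M_def)
  ultimately show ?case by (simp add: mult.assoc)
qed simp

lemma central_binomial_ratio_ge:
  assumes "w < s"
  shows "(1 / 16) ^ w \<le> real (2 * s - 1 - w choose s) / real (2 * s - 1 choose s)"
proof -
  have "(1 / 16) ^ w * real (2 * s - 1 choose s) \<le> real (2 * s - 1 - w choose s)"
  proof (cases "s \<le> 2 * w")
    case True
    have "2 * s - 1 choose s \<le> 2 ^ (2 * s - 1)" by (rule binomial_le_pow2)
    also have "\<dots> \<le> 2 ^ (4 * w)" using True by (intro power_increasing) auto
    finally have "real (2 * s - 1 choose s) \<le> real (2 ^ (4 * w))" by (rule of_nat_mono)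
    then have "(1 / 16) ^ w * real (2 * s - 1 choose s) \<le> 1"
      by (simp add: power_mult power_divide divide_le_eq)
    also have "\<dots> \<le> real (2 * s - 1 - w choose s)" using assms by (simp add: Suc_le_eq)
    finally show ?thesis .
  next
    case False
    have "(1 / 16) ^ w * real (2 * s - 1 choose s) \<le> (1 / 4) ^ w * real (2 * s - 1 choose s)"
      by (intro mult_right_mono power_mono) auto
    also have "\<dots> \<le> real (2 * s - 1 - w choose s)"
      using False by (intro binomial_diff_ge) (auto simp: of_nat_diff)
    finally show ?thesis .
  qed
  moreover have "0 < real (2 * s - 1 choose s)" using assms by simp
  ultimately show ?thesis by (simp add: field_simps)
qed

lemma one_minus_ratio_ge_powr:
  fixes m w :: real
  assumes m: "exp 1 \<le> m" and w: "0 \<le> w" "w \<le> m - 1"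
  shows "m powr (- (2 * w / m)) \<le> 1 - w / m"
proof (cases "2 * w \<le> m")
  case True
  define x where "x = w / m"
  have m_pos: "m > 0" using w by linarith
  then have x: "0 \<le> x" "x \<le> 1 / 2" using True w by (auto simp: x_def field_simps)
  have "1 \<le> ln m" using m m_pos by (simp add: ln_ge_iff)
  have "m powr (- (2 * w / m)) = exp (- (2 * x * ln m))"
    using m_pos by (simp add: powr_def x_def)
  also have "\<dots> \<le> exp (- (2 * x))"
    using x \<open>1 \<le> ln m\<close> by (simp add: mult_le_cancel_left1)
  also have "\<dots> \<le> exp (ln (1 - x))"
  proof -
    have "x * x \<le> x * (1 / 2)" using x by (intro mult_left_mono) auto
    then have "- (2 * x) \<le> - x - 2 * x\<^sup>2" by (simp add: power2_eq_square)
    also have "\<dots> \<le> ln (1 - x)" using x by (intro ln_one_minus_pos_lower_bound)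
    finally show ?thesis by simp
  qed
  also have "\<dots> = 1 - x" using x by simp
  finally show ?thesis by (simp only: x_def)
next
  case False
  have m_ge_1: "1 \<le> m" using w by linarith
  then have "m powr (- (2 * w / m)) \<le> m powr (- 1)"
    using False by (intro powr_mono) (auto simp: field_simps)
  also have "\<dots> = 1 / m" using m_ge_1 by (simp add: powr_minus_divide)
  also have "\<dots> \<le> 1 - w / m" using m_ge_1 w by (simp add: field_simps)
  finally show ?thesis .
qed

lemma prod_one_minus_ratio_ge_powr:
  fixes \<rho> w :: "'a \<Rightarrow> real"
  assumes J: "finite J" and m: "exp 1 \<le> m" and \<rho>: "\<And>j. j \<in> J \<Longrightarrow> m \<le> \<rho> j" "\<And>j. j \<in> J \<Longrightarrow> \<rho> j \<le> r"
    and w: "\<And>j. j \<in> J \<Longrightarrow> 0 \<le> w j" "\<And>j. j \<in> J \<Longrightarrow> w j \<le> \<rho> j - 1" "(\<Sum>j\<in>J. w j) \<le> c * m"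
    and r: "1 \<le> r"
  shows "r powr (- (2 * c)) \<le> (\<Prod>j\<in>J. 1 - w j / \<rho> j)"
proof -
  have m_pos: "m > 0" using m exp_gt_zero[of "1::real"] by linarith
  have "r powr (- (2 * c)) \<le> r powr (\<Sum>j\<in>J. - (2 * w j / m))"
  proof (rule powr_mono)
    have "(\<Sum>j\<in>J. 2 * w j / m) = 2 * (\<Sum>j\<in>J. w j) / m"
      by (simp add: sum_distrib_left sum_divide_distrib)
    also have "\<dots> \<le> 2 * c" using w(3) m_pos by (simp add: divide_le_eq)
    finally show "- (2 * c) \<le> (\<Sum>j\<in>J. - (2 * w j / m))" by (simp add: sum_negf)
  qed (fact r)
  also have "\<dots> = (\<Prod>j\<in>J. r powr (- (2 * w j / m)))" using J r by (simp add: powr_sum)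
  also have "\<dots> \<le> (\<Prod>j\<in>J. 1 - w j / \<rho> j)"
  proof (rule prod_mono, intro conjI)
    fix j assume j: "j \<in> J"
    have \<rho>_pos: "0 < \<rho> j" using \<rho>(1)[OF j] m_pos by linarith
    have "r powr (- (2 * w j / m)) \<le> \<rho> j powr (- (2 * w j / m))"
      using \<rho>[OF j] \<rho>_pos w(1)[OF j] m_pos by (intro powr_mono2') auto
    also have "\<dots> \<le> \<rho> j powr (- (2 * w j / \<rho> j))"
      using \<rho>(1)[OF j] \<rho>_pos w(1,2)[OF j] m_pos by (intro powr_mono) (auto intro!: divide_left_mono)
    also have "\<dots> \<le> 1 - w j / \<rho> j"
      using \<rho>(1)[OF j] m w(1,2)[OF j] by (intro one_minus_ratio_ge_powr) auto
    finally show "r powr (- (2 * w j / m)) \<le> 1 - w j / \<rho> j" .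
  qed simp
  finally show ?thesis .
qed

section \<open>Blown-up projective planes\<close>

text \<open>The chain of \<open>t\<close> further blocks makes up for the edge size not being a multiple of \<open>q + 1\<close>.
  Given a small set, the last chain block that it avoids provides an edge missing it; if there is
  no such block, too few of its vertices remain to block all lines.\<close>

locale blown_up_plane = polar_plane q P inc
  for q and P :: "'p set" and inc +
  fixes s t :: nat
  assumes order_ge_2: "2 \<le> q" and copies_ge_1: "1 \<le> s" and chain_length_le: "t \<le> q"
begin

definition core_size :: nat where
  "core_size = (q + 1) * s"

definition edge_size :: nat where
  "edge_size = core_size + t"

definition blocks :: "('p + nat) set" where
  "blocks = P <+> {0<..t}"

definition block_size :: "'p + nat \<Rightarrow> nat" where
  "block_size = case_sum (\<lambda>_. 2 * s - 1) (\<lambda>j. core_size + j)"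

definition line_profile :: "'p \<Rightarrow> 'p + nat \<Rightarrow> nat" where
  "line_profile y = case_sum (\<lambda>x. if x \<in> line y then s else 0) (\<lambda>_. 1)"

definition chain_profile :: "nat \<Rightarrow> 'p + nat \<Rightarrow> nat" where
  "chain_profile i =
    case_sum (\<lambda>_. 0) (\<lambda>j. if j < i then 0 else if j = i then core_size + i else 1)"

definition profiles :: "('p + nat \<Rightarrow> nat) set" where
  "profiles = line_profile ` P \<union> chain_profile ` {0<..t}"

lemma core_size_ge: "q + 1 \<le> core_size"
  using copies_ge_1 mult_le_mono2[of 1 s "q + 1"] by (simp add: core_size_def)

lemma edge_size_bounds: "q + 1 \<le> edge_size" "edge_size \<le> 2 * core_size"
  using core_size_ge chain_length_le by (auto simp: edge_size_def)

lemma sum_blocks: "(\<Sum>a\<in>blocks. g a) = (\<Sum>x\<in>P. g (Inl x)) + (\<Sum>j\<in>{0<..t}. g (Inr j))"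
  for g :: "_ \<Rightarrow> nat"
  using finite_points by (simp add: blocks_def sum.Plus comp_def)

lemma miss_probability_blocks:
  "miss_probability blocks b d w =
    (\<Prod>x\<in>P. real (b (Inl x) - w (Inl x) choose d (Inl x)) / real (b (Inl x) choose d (Inl x))) *
    (\<Prod>j\<in>{0<..t}.
      real (b (Inr j) - w (Inr j) choose d (Inr j)) / real (b (Inr j) choose d (Inr j)))"
  using finite_points by (simp add: miss_probability_def blocks_def prod.Plus comp_def)

lemma sum_line_profile:
  assumes "y \<in> P"
  shows "(\<Sum>a\<in>blocks. line_profile y a) = edge_size"
proof -
  have "P \<inter> line y = line y" by (auto simp: line_def)
  then have "(\<Sum>x\<in>P. if x \<in> line y then s else 0) = core_size"
    using card_line[OF assms] finite_points by (simp add: sum.If_cases core_size_def)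
  then show ?thesis by (simp add: sum_blocks line_profile_def edge_size_def)
qed

lemma sum_chain_profile:
  assumes "i \<in> {0<..t}"
  shows "(\<Sum>a\<in>blocks. chain_profile i a) = edge_size"
proof -
  have "(\<Sum>j\<in>{0<..t}. chain_profile i (Inr j)) = (\<Sum>j\<in>insert i {i<..t}. chain_profile i (Inr j))"
    using assms by (intro sum.mono_neutral_right) (auto simp: chain_profile_def)
  also have "\<dots> = core_size + i + (\<Sum>j\<in>{i<..t}. chain_profile i (Inr j))"
    by (simp add: chain_profile_def)
  also have "(\<Sum>j\<in>{i<..t}. chain_profile i (Inr j)) = (\<Sum>j\<in>{i<..t}. 1)"
    by (intro sum.cong) (auto simp: chain_profile_def)
  finally show ?thesis using assms by (simp add: sum_blocks chain_profile_def edge_size_def)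
qed

lemma line_profiles_meet:
  assumes "y \<in> P" "y' \<in> P"
  shows "\<exists>a\<in>blocks. block_size a < line_profile y a + line_profile y' a"
proof -
  obtain z where "z \<in> P" "inc y z" "inc y' z" using ex_joining_line assms by blast
  then have "Inl z \<in> blocks" "z \<in> line y" "z \<in> line y'"
    using inc_sym assms by (auto simp: blocks_def line_def)
  then show ?thesis
    using copies_ge_1 by (intro bexI[of _ "Inl z"]) (simp_all add: line_profile_def block_size_def)
qed

lemma line_chain_profiles_meet:
  assumes "i \<in> {0<..t}"
  shows "\<exists>a\<in>blocks. block_size a < line_profile y a + chain_profile i a"
  using assms
  by (intro bexI[of _ "Inr i"])
    (auto simp: blocks_def line_profile_def chain_profile_def block_size_def)

lemma chain_profiles_meet:
  assumes "i \<in> {0<..t}" "i' \<in> {0<..t}"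
  shows "\<exists>a\<in>blocks. block_size a < chain_profile i a + chain_profile i' a"
  using assms core_size_ge
  by (intro bexI[of _ "Inr (max i i')"])
    (auto simp: blocks_def chain_profile_def block_size_def max_def)

sublocale intersecting_profiles edge_size blocks block_size profiles
proof
  show "finite blocks" "finite profiles"
    using finite_points by (simp_all add: blocks_def profiles_def)
  show "(\<Sum>a\<in>blocks. d a) = edge_size" if "d \<in> profiles" for d
    using that sum_line_profile sum_chain_profile by (auto simp: profiles_def)
  fix d d' assume "d \<in> profiles" "d' \<in> profiles"
  then have "d \<in> line_profile ` P \<or> d \<in> chain_profile ` {0<..t}"
    "d' \<in> line_profile ` P \<or> d' \<in> chain_profile ` {0<..t}"
    by (auto simp: profiles_def)
  then show "\<exists>a\<in>blocks. block_size a < d a + d' a"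
  proof (elim disjE imageE)
    fix i y assume "d = chain_profile i" "i \<in> {0<..t}" "d' = line_profile y"
    then show ?thesis using line_chain_profiles_meet[of i y] by (simp add: add.commute)
  qed (use line_profiles_meet line_chain_profiles_meet chain_profiles_meet in simp_all)
qed

lemma card_profiles_le: "card profiles \<le> (q + 1)\<^sup>2"
proof -
  have "card profiles \<le> card (line_profile ` P) + card (chain_profile ` {0<..t})"
    unfolding profiles_def by (rule card_Un_le)
  also have "\<dots> \<le> card P + card {0<..t}"
    using finite_points by (intro add_mono card_image_le) auto
  also have "\<dots> \<le> (q + 1)\<^sup>2"
    using card_points chain_length_le by (simp add: power2_eq_square)
  finally show ?thesis .
qed

lemma sum_block_size_bounds:
  "1 \<le> (\<Sum>a\<in>blocks. block_size a)" "(\<Sum>a\<in>blocks. block_size a) \<le> (3 * q + 2) * edge_size"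
proof -
  have sum: "(\<Sum>a\<in>blocks. block_size a) =
      (q\<^sup>2 + q + 1) * (2 * s - 1) + (\<Sum>j\<in>{0<..t}. core_size + j)"
    by (simp add: sum_blocks block_size_def card_points)
  have "1 \<le> (q\<^sup>2 + q + 1) * (2 * s - 1)" using copies_ge_1 by simp
  then show "1 \<le> (\<Sum>a\<in>blocks. block_size a)" unfolding sum by linarith
  have "(q\<^sup>2 + q + 1) * (2 * s - 1) \<le> (q + 1)\<^sup>2 * (2 * s)"
    by (intro mult_le_mono) (auto simp: power2_eq_square)
  also have "\<dots> = 2 * (q + 1) * core_size" by (simp only: core_size_def power2_eq_square ac_simps)
  also have "\<dots> \<le> 2 * (q + 1) * edge_size" by (intro mult_le_mono2) (simp add: edge_size_def)
  finally have core: "(q\<^sup>2 + q + 1) * (2 * s - 1) \<le> 2 * (q + 1) * edge_size" .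
  have "(\<Sum>j\<in>{0<..t}. core_size + j) \<le> (\<Sum>j\<in>{0<..t}. edge_size)"
    by (intro sum_mono) (simp add: edge_size_def)
  also have "\<dots> \<le> q * edge_size" using chain_length_le by simp
  finally have "(\<Sum>a\<in>blocks. block_size a) \<le> 2 * (q + 1) * edge_size + q * edge_size"
    unfolding sum using core by (rule add_mono[rotated])
  also have "\<dots> = (3 * q + 2) * edge_size" by (simp add: algebra_simps)
  finally show "(\<Sum>a\<in>blocks. block_size a) \<le> (3 * q + 2) * edge_size" .
qed

lemma chain_tail_miss_ge:
  assumes hit: "\<And>j. j \<in> {i<..t} \<Longrightarrow> 1 \<le> v j" and small: "(\<Sum>j\<in>{i<..t}. v j) < edge_size"
  shows "1 / real edge_size ^ 4 \<le>
    (\<Prod>j\<in>{i<..t}. real (core_size + j - v j) / real (core_size + j))"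
proof -
  have v_less: "v j < core_size + j" if j: "j \<in> {i<..t}" for j
  proof -
    have "(\<Sum>j'\<in>{j<..t}. 1) \<le> (\<Sum>j'\<in>{j<..t}. v j')" using hit j by (intro sum_mono) auto
    then have "v j + (t - j) \<le> (\<Sum>j'\<in>insert j {j<..t}. v j')" by simp
    also have "\<dots> \<le> (\<Sum>j\<in>{i<..t}. v j)" using j by (intro sum_mono2) auto
    finally show ?thesis using small j by (simp add: edge_size_def)
  qed
  have size: "1 \<le> real edge_size" using edge_size_bounds(1) by simp
  have "1 / real edge_size ^ 4 = real edge_size powr (- (2 * 2))"
    using size by (simp add: powr_minus_divide powr_numeral)
  also have "\<dots> \<le> (\<Prod>j\<in>{i<..t}. 1 - real (v j) / real (core_size + j))"
  proof (rule prod_one_minus_ratio_ge_powr[where m = "real core_size"])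
    have "real 3 \<le> real core_size" using core_size_ge order_ge_2 by (intro of_nat_mono) simp
    then show "exp 1 \<le> real core_size" using exp_le by simp
    have "real (\<Sum>j\<in>{i<..t}. v j) \<le> real (2 * core_size)"
      using small edge_size_bounds(2) by (intro of_nat_mono) simp
    then show "(\<Sum>j\<in>{i<..t}. real (v j)) \<le> 2 * real core_size" by simp
    show "real (v j) \<le> real (core_size + j) - 1" if "j \<in> {i<..t}" for j
      using v_less[OF that] by simp
  qed (use size in \<open>auto simp: edge_size_def\<close>)
  also have "\<dots> = (\<Prod>j\<in>{i<..t}. real (core_size + j - v j) / real (core_size + j))"
  proof (rule prod.cong[OF refl])
    fix j assume "j \<in> {i<..t}"
    then show "1 - real (v j) / real (core_size + j) =
        real (core_size + j - v j) / real (core_size + j)"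
      using v_less[of j] by (simp add: of_nat_diff field_simps)
  qed
  finally show ?thesis .
qed

lemma chain_profile_miss_ge:
  assumes w: "(\<Sum>a\<in>blocks. w a) < edge_size" and i: "i \<in> {0<..t}" "w (Inr i) = 0"
    and hit: "\<And>j. j \<in> {i<..t} \<Longrightarrow> 1 \<le> w (Inr j)"
  shows "1 / real edge_size ^ 4 \<le> miss_probability blocks block_size (chain_profile i) w"
proof -
  have "miss_probability blocks block_size (chain_profile i) w = (\<Prod>j\<in>{0<..t}.
      real (core_size + j - w (Inr j) choose chain_profile i (Inr j)) /
      real (core_size + j choose chain_profile i (Inr j)))"
    unfolding miss_probability_blocks by (simp add: block_size_def chain_profile_def)
  also have "\<dots> = (\<Prod>j\<in>{i<..t}.
      real (core_size + j - w (Inr j) choose chain_profile i (Inr j)) /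
      real (core_size + j choose chain_profile i (Inr j)))"
    using i by (intro prod.mono_neutral_right) (auto simp: chain_profile_def)
  also have "\<dots> = (\<Prod>j\<in>{i<..t}. real (core_size + j - w (Inr j)) / real (core_size + j))"
    by (intro prod.cong) (auto simp: chain_profile_def)
  also have "1 / real edge_size ^ 4 \<le> \<dots>"
  proof (rule chain_tail_miss_ge[OF hit])
    have "(\<Sum>j\<in>{i<..t}. w (Inr j)) \<le> (\<Sum>j\<in>{0<..t}. w (Inr j))" by (intro sum_mono2) auto
    then show "(\<Sum>j\<in>{i<..t}. w (Inr j)) < edge_size" using w by (simp add: sum_blocks)
  qed
  finally show ?thesis .
qed

lemma light_line_miss_ge:
  assumes "y \<in> P" and light: "\<And>x. x \<in> line y \<Longrightarrow> u x < s" "(\<Sum>x\<in>line y. u x) \<le> 2 * s"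
  shows "1 / 256 ^ s \<le> (\<Prod>x\<in>P. real (2 * s - 1 - u x choose (if x \<in> line y then s else 0)) /
    real (2 * s - 1 choose (if x \<in> line y then s else 0)))"
proof -
  have line: "line y \<subseteq> P" by (auto simp: line_def)
  have "1 / 256 ^ s = ((1 / 16) ^ (2 * s) :: real)" by (simp add: power_mult power_divide)
  also have "\<dots> \<le> (1 / 16) ^ (\<Sum>x\<in>line y. u x)" using light(2) by (intro power_decreasing) auto
  also have "\<dots> = (\<Prod>x\<in>line y. (1 / 16) ^ u x)" by (simp add: power_sum)
  also have "\<dots> \<le> (\<Prod>x\<in>line y. real (2 * s - 1 - u x choose s) / real (2 * s - 1 choose s))"
    using light(1) central_binomial_ratio_ge by (intro prod_mono) auto
  also have "\<dots> = (\<Prod>x\<in>P. real (2 * s - 1 - u x choose (if x \<in> line y then s else 0)) /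
      real (2 * s - 1 choose (if x \<in> line y then s else 0)))"
    using finite_points line by (intro prod.mono_neutral_cong_left) auto
  finally show ?thesis .
qed

lemma line_profile_miss_ge:
  assumes w: "(\<Sum>a\<in>blocks. w a) < edge_size" and hit: "\<And>j. j \<in> {0<..t} \<Longrightarrow> 1 \<le> w (Inr j)"
  shows "\<exists>y\<in>P. 1 / (real edge_size ^ 4 * 256 ^ s) \<le>
    miss_probability blocks block_size (line_profile y) w"
proof -
  have "(\<Sum>j\<in>{0<..t}. 1) \<le> (\<Sum>j\<in>{0<..t}. w (Inr j))" using hit by (intro sum_mono) auto
  then have "(\<Sum>x\<in>P. w (Inl x)) < (q + 1) * s"
    using w by (simp add: sum_blocks edge_size_def core_size_def)
  then obtain y where y: "y \<in> P" "\<And>x. x \<in> line y \<Longrightarrow> w (Inl x) < s"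
      "(\<Sum>x\<in>line y. w (Inl x)) \<le> 2 * s"
    using ex_light_line[of "\<lambda>x. w (Inl x)" s] order_ge_2 by auto
  have "(\<Sum>j\<in>{0<..t}. w (Inr j)) < edge_size" using w by (simp add: sum_blocks)
  then have "1 / 256 ^ s * (1 / real edge_size ^ 4) \<le>
      (\<Prod>x\<in>P. real (2 * s - 1 - w (Inl x) choose (if x \<in> line y then s else 0)) /
        real (2 * s - 1 choose (if x \<in> line y then s else 0))) *
      (\<Prod>j\<in>{0<..t}. real (core_size + j - w (Inr j)) / real (core_size + j))"
    by (intro mult_mono light_line_miss_ge chain_tail_miss_ge y hit prod_nonneg) auto
  also have "\<dots> = miss_probability blocks block_size (line_profile y) w"
    by (simp add: miss_probability_blocks block_size_def line_profile_def)
  finally show ?thesis using y(1) by (auto simp: mult.commute)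
qed

lemma profiles_miss_ge:
  assumes w: "(\<Sum>a\<in>blocks. w a) < edge_size"
  shows "\<exists>d\<in>profiles. 1 / (real edge_size ^ 4 * 256 ^ s) \<le> miss_probability blocks block_size d w"
proof (cases "\<exists>j\<in>{0<..t}. w (Inr j) = 0")
  case True
  define i where "i = Max {j\<in>{0<..t}. w (Inr j) = 0}"
  have "i \<in> {j\<in>{0<..t}. w (Inr j) = 0}" unfolding i_def using True by (intro Max_in) auto
  then have i: "i \<in> {0<..t}" "w (Inr i) = 0" by auto
  have "1 \<le> w (Inr j)" if "j \<in> {i<..t}" for j
  proof (rule ccontr)
    assume "\<not> 1 \<le> w (Inr j)"
    then have "j \<le> i" unfolding i_def using that by (intro Max_ge) auto
    then show False using that by simp
  qed
  then have miss: "1 / real edge_size ^ 4 \<le> miss_probability blocks block_size (chain_profile i) w"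
    using chain_profile_miss_ge[OF w i] by blast
  have "real edge_size ^ 4 * 1 \<le> real edge_size ^ 4 * 256 ^ s" by (intro mult_left_mono) auto
  then have "1 / (real edge_size ^ 4 * 256 ^ s) \<le> 1 / real edge_size ^ 4"
    using edge_size_bounds(1) by (intro divide_left_mono) auto
  also note miss
  finally show ?thesis
    using i(1) by (intro bexI[of _ "chain_profile i"]) (simp_all add: profiles_def)
next
  case False
  then have "1 \<le> w (Inr j)" if "j \<in> {0<..t}" for j using that by (simp add: Suc_le_eq)
  then show ?thesis using line_profile_miss_ge[OF w] by (auto simp: profiles_def)
qed

lemma min_edges_le_card_profiles:
  assumes n: "(\<Sum>a\<in>blocks. block_size a) \<le> n"
  shows "min_edges n edge_size \<le>
    card profiles * ((\<Sum>a\<in>blocks. block_size a) * edge_size ^ 4 * 256 ^ s)"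
proof (rule min_edges_le_sample[OF _ n])
  let ?N = "\<Sum>a\<in>blocks. block_size a"
  have size: "1 \<le> edge_size" using edge_size_bounds(1) by simp
  then show "1 \<le> edge_size" .
  show "0 < 1 / (real edge_size ^ 4 * 256 ^ s)" using size by simp
  have "2 ^ ?N < exp (1::real) ^ ?N"
  proof (rule power_strict_mono)
    have "exp (ln 2) < exp (1::real)" using ln_2_less_1 by (simp only: exp_less_cancel_iff)
    then show "2 < exp (1::real)" by simp
  qed (use sum_block_size_bounds(1) in auto)
  also have "\<dots> = exp (real ?N)" by (simp add: exp_of_nat_mult[symmetric])
  also have "real ?N =
      1 / (real edge_size ^ 4 * 256 ^ s) * real (?N * edge_size ^ 4 * 256 ^ s)"
    using size by simp
  finally show "2 ^ ?N <
      exp (1 / (real edge_size ^ 4 * 256 ^ s) * real (?N * edge_size ^ 4 * 256 ^ s))" .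
qed (rule profiles_miss_ge)

lemma edge_size_le_power: "edge_size \<le> q ^ (s + 2)"
proof -
  have "edge_size \<le> (q + 1) * (s + 1)"
    using chain_length_le by (simp add: edge_size_def core_size_def algebra_simps)
  also have "\<dots> \<le> (q * q) * q ^ s"
  proof (rule mult_le_mono)
    have "q * 2 \<le> q * q" using order_ge_2 by (intro mult_le_mono2)
    then show "q + 1 \<le> q * q" using order_ge_2 by linarith
    have "s + 1 \<le> 2 ^ s" using less_exp[of s] by linarith
    also have "\<dots> \<le> q ^ s" using order_ge_2 by (intro power_mono) auto
    finally show "s + 1 \<le> q ^ s" .
  qed
  finally show ?thesis by (simp add: power_add power2_eq_square mult.commute)
qed

lemma min_edges_le_power:
  assumes n: "(3 * q + 2) * edge_size \<le> n"
  shows "min_edges n edge_size \<le> q ^ (34 * s)"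
proof -
  let ?N = "\<Sum>a\<in>blocks. block_size a"
  have "min_edges n edge_size \<le> card profiles * (?N * edge_size ^ 4 * 256 ^ s)"
    using sum_block_size_bounds(2) n by (intro min_edges_le_card_profiles) (rule le_trans)
  also have "\<dots> \<le> edge_size\<^sup>2 * ((3 * edge_size * edge_size) * edge_size ^ 4 * 256 ^ s)"
  proof (intro mult_le_mono order.refl)
    have "(q + 1)\<^sup>2 \<le> edge_size\<^sup>2" using edge_size_bounds(1) by (intro power_mono) auto
    then show "card profiles \<le> edge_size\<^sup>2" using card_profiles_le by linarith
    have "(3 * q + 2) * edge_size \<le> 3 * edge_size * edge_size"
      using edge_size_bounds(1) by (intro mult_le_mono1) simp
    then show "?N \<le> 3 * edge_size * edge_size" using sum_block_size_bounds(2) by linarith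
  qed
  also have "\<dots> = 3 * (edge_size ^ 8 * (2 ^ 8) ^ s)"
    by (simp add: power_numeral_reduce)
  also have "\<dots> \<le> q\<^sup>2 * ((q ^ (s + 2)) ^ 8 * (q ^ 8) ^ s)"
  proof (intro mult_le_mono power_mono edge_size_le_power)
    have "2\<^sup>2 \<le> q\<^sup>2" using order_ge_2 by (intro power_mono) auto
    then show "3 \<le> q\<^sup>2" by simp
  qed (use order_ge_2 in auto)
  also have "\<dots> = q ^ (16 * s + 18)"
    by (simp add: power_mult[symmetric] power_add[symmetric] algebra_simps)
  also have "\<dots> \<le> q ^ (34 * s)" using order_ge_2 copies_ge_1 by (intro power_increasing) auto
  finally show ?thesis .
qed

lemma min_edges_le_powr_ratio:
  assumes n: "(3 * q + 2) * edge_size \<le> n" "n \<le> 6 * (q + 1) * edge_size"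
  shows "min_edges n edge_size \<le>
    (real n / real edge_size) powr (204 * (real edge_size)\<^sup>2 / real n)"
proof -
  have size: "real edge_size > 0" using edge_size_bounds(1) by simp
  have "q * edge_size \<le> n" using n(1) by (simp add: algebra_simps)
  then have "real (q * edge_size) \<le> real n" by (rule of_nat_mono)
  then have q_le: "real q \<le> real n / real edge_size" using size by (simp add: field_simps)
  have "real n > 0" using n(1) edge_size_bounds(1) by (cases n) auto
  have "real (min_edges n edge_size) \<le> real (q ^ (34 * s))"
    using min_edges_le_power[OF n(1)] by (rule of_nat_mono)
  also have "\<dots> = real q powr (34 * real s)"
    using order_ge_2 by (simp add: powr_realpow[symmetric])
  also have "\<dots> \<le> (real n / real edge_size) powr (34 * real s)"
    using q_le by (intro powr_mono2) auto
  also have "\<dots> \<le> (real n / real edge_size) powr (204 * (real edge_size)\<^sup>2 / real n)"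
  proof (rule powr_mono)
    have "s * n \<le> s * (6 * (q + 1) * edge_size)" using n(2) by (rule mult_le_mono2)
    also have "\<dots> = 6 * core_size * edge_size" by (simp only: core_size_def ac_simps)
    also have "\<dots> \<le> 6 * edge_size * edge_size"
      by (intro mult_le_mono) (auto simp: edge_size_def)
    finally have "real (s * n) \<le> real (6 * edge_size * edge_size)" by (rule of_nat_mono)
    then show "34 * real s \<le> 204 * (real edge_size)\<^sup>2 / real n"
      using \<open>real n > 0\<close> by (simp add: field_simps power2_eq_square)
    show "1 \<le> real n / real edge_size" using q_le order_ge_2 by linarith
  qed
  finally show ?thesis .
qed

end

section \<open>The upper bound\<close>

lemma ex_dyadic_order:
  fixes n r :: nat
  assumes r: "r \<ge> 1" and n: "8 * r \<le> n"
  shows "\<exists>k\<ge>1. (3 * 2 ^ k + 2) * r \<le> n \<and> n < 6 * (2 ^ k + 1) * r"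
proof -
  define fits where "fits k \<longleftrightarrow> (3 * 2 ^ k + 2) * r \<le> n" for k
  define k where "k = (GREATEST k. fits k)"
  have bound: "k \<le> n" if "fits k" for k
  proof -
    have "k < 2 ^ k" by simp
    also have "\<dots> \<le> (3 * 2 ^ k + 2) * 1" by simp
    also have "\<dots> \<le> (3 * 2 ^ k + 2) * r" using r by (intro mult_le_mono2)
    finally show ?thesis using that by (simp add: fits_def)
  qed
  have "fits 1" using n by (simp add: fits_def)
  then have "fits k" "1 \<le> k"
    unfolding k_def using bound by (auto intro: GreatestI_nat Greatest_le_nat)
  moreover have "n < 6 * (2 ^ k + 1) * r"
  proof (rule ccontr)
    assume "\<not> ?thesis"
    then have "fits (Suc k)" by (simp add: fits_def algebra_simps)
    then have "Suc k \<le> k" unfolding k_def using bound by (rule Greatest_le_nat)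
    then show False by simp
  qed
  ultimately show ?thesis by (auto simp: fits_def)
qed

lemma min_edges_le_plane_range:
  assumes r: "r \<ge> 2" and n: "8 * r \<le> n" "n \<le> 3 * r\<^sup>2"
  shows "min_edges n r \<le> (real n / real r) powr (204 * (real r)\<^sup>2 / real n)"
proof -
  obtain k where k: "1 \<le> k" "(3 * 2 ^ k + 2) * r \<le> n" "n < 6 * (2 ^ k + 1) * r"
    using ex_dyadic_order[of r n] r n(1) by auto
  define q where "q = (2::nat) ^ k"
  have q: "(3 * q + 2) * r \<le> n" "n < 6 * (q + 1) * r" using k by (simp_all add: q_def)
  have "(2::nat) ^ 1 \<le> 2 ^ k" using k(1) by (intro power_increasing) auto
  then have q_ge_2: "2 \<le> q" by (simp add: q_def)
  have "(3 * q + 2) * r \<le> (3 * r) * r" using q(1) n(2) by (simp add: power2_eq_square)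
  then have "0 < r \<longrightarrow> 3 * q + 2 \<le> 3 * r" by (simp only: mult_le_cancel2)
  then have "q + 1 \<le> r" using r by linarith
  define s where "s = r div (q + 1)"
  define t where "t = r mod (q + 1)"
  have "1 \<le> s" using div_le_mono[OF \<open>q + 1 \<le> r\<close>, of "q + 1"] by (simp add: s_def)
  moreover have "t \<le> q" using mod_less_divisor[of "q + 1" r] by (simp add: t_def)
  moreover obtain P :: "bit alg_closure projective_point set" where "polar_plane q P incident"
    using ex_polar_plane_two_power[OF k(1)] by (auto simp: q_def)
  ultimately interpret blown_up_plane q P incident s t
    using q_ge_2 by (intro blown_up_plane.intro blown_up_plane_axioms.intro)
  have edge_size: "edge_size = r"
    unfolding edge_size_def core_size_def unfolding s_def t_def by (rule mult_div_mod_eq)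
  show ?thesis using min_edges_le_powr_ratio[of n] q unfolding edge_size by simp
qed

lemma min_edges_le_linear_range:
  assumes r: "r \<ge> 2" and n: "2 * r - 1 \<le> n" "n \<le> 8 * r"
  shows "min_edges n r \<le> (real n / real r) powr (204 * (real r)\<^sup>2 / real n)"
proof -
  have "min_edges n r \<le> 2 ^ (2 * r - 1)" using min_edges_le_two_power r n by simp
  also have "\<dots> \<le> 2 ^ (2 * r)" by (intro power_increasing) auto
  finally have "real (min_edges n r) \<le> real (2 ^ (2 * r))" by (rule of_nat_mono)
  also have "\<dots> = 4 ^ r" by (simp add: power_mult)
  also have "\<dots> \<le> ((3 / 2) ^ 4) ^ r" by (intro power_mono) (auto simp: power_divide)
  also have "\<dots> = (3 / 2) ^ (4 * r)" by (simp only: power_mult)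
  also have "\<dots> = (3 / 2) powr real (4 * r)" by (subst powr_realpow) auto
  also have "\<dots> = (3 / 2) powr (4 * real r)" by simp
  also have "\<dots> \<le> (real n / real r) powr (4 * real r)"
    using n(1) r by (intro powr_mono2) (auto simp: field_simps)
  also have "\<dots> \<le> (real n / real r) powr (204 * (real r)\<^sup>2 / real n)"
  proof (rule powr_mono)
    have "real n \<le> 8 * real r" "real n > 0" using n r by auto
    then have "4 * real r * real n \<le> 4 * real r * (8 * real r)" by (intro mult_left_mono) auto
    also have "\<dots> \<le> 204 * (real r)\<^sup>2" by (simp add: power2_eq_square)
    finally show "4 * real r \<le> 204 * (real r)\<^sup>2 / real n"
      using \<open>real n > 0\<close> by (simp add: field_simps)
    show "1 \<le> real n / real r" using n r by (simp add: field_simps)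
  qed
  finally show ?thesis .
qed

lemma min_edges_le_quadratic_range:
  assumes "r \<ge> 2" "2 * r - 1 \<le> n" "n \<le> 3 * r\<^sup>2"
  shows "min_edges n r \<le> (real n / real r) powr (204 * (real r)\<^sup>2 / real n)"
proof (cases "8 * r \<le> n")
  case True
  then show ?thesis using assms(1,3) by (intro min_edges_le_plane_range)
next
  case False
  then show ?thesis using assms(1,2) by (intro min_edges_le_linear_range) simp_all
qed

lemma min_edges_le_powr:
  assumes r: "r \<ge> 2" and n: "2 * r - 1 \<le> n" and nK: "real n \<le> K * (real r)\<^sup>2" and K: "K > 0"
  shows "min_edges n r \<le> (real n / real r) powr ((204 + 68 * K) * (real r)\<^sup>2 / real n)"
proof -
  have n_pos: "real n > 0" and base: "1 \<le> real n / real r" using r n by (auto simp: field_simps)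
  show ?thesis
  proof (cases "n \<le> 3 * r\<^sup>2")
    case True
    have "min_edges n r \<le> (real n / real r) powr (204 * (real r)\<^sup>2 / real n)"
      using r n True by (rule min_edges_le_quadratic_range)
    also have "\<dots> \<le> (real n / real r) powr ((204 + 68 * K) * (real r)\<^sup>2 / real n)"
      using K base by (intro powr_mono divide_right_mono mult_right_mono) auto
    finally show ?thesis .
  next
    case False
    have "2 * r \<le> 3 * r\<^sup>2" using r by (simp add: power2_eq_square)
    then have range: "2 * r - 1 \<le> 3 * r\<^sup>2" by simp
    have "min_edges n r \<le> min_edges (3 * r\<^sup>2) r"
      using min_edges_antimono[OF _ range] False r by simp
    also have "real \<dots> \<le> (real (3 * r\<^sup>2) / real r) powr (204 * (real r)\<^sup>2 / real (3 * r\<^sup>2))"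
      using min_edges_le_quadratic_range[OF r range] by simp
    also have "\<dots> = (3 * real r) powr 68" using r by (simp add: power2_eq_square)
    also have "\<dots> \<le> (real n / real r) powr 68"
    proof (rule powr_mono2)
      have "real (3 * r\<^sup>2) \<le> real n" using False by (intro of_nat_mono) simp
      then show "3 * real r \<le> real n / real r" using r by (simp add: field_simps power2_eq_square)
    qed auto
    also have "\<dots> \<le> (real n / real r) powr ((204 + 68 * K) * (real r)\<^sup>2 / real n)"
    proof (rule powr_mono)
      have "68 * real n \<le> 68 * K * (real r)\<^sup>2" using nK by simp
      also have "\<dots> \<le> (204 + 68 * K) * (real r)\<^sup>2" by (intro mult_right_mono) auto
      finally show "68 \<le> (204 + 68 * K) * (real r)\<^sup>2 / real n"
        using n_pos by (simp add: field_simps)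
    qed (rule base)
    finally show ?thesis by simp
  qed
qed

theorem theorem1p1:
  fixes K :: real
  assumes "K > 0"
  shows "\<exists>c C :: real. c > 0 \<and> C > 0 \<and>
    (\<forall>r n :: nat. 2 \<le> r \<longrightarrow> 2 * r - 1 \<le> n \<longrightarrow> real n \<le> K * (real r)\<^sup>2 \<longrightarrow>
       2 powr (c * (real r)\<^sup>2 / real n) \<le> real (min_edges n r) \<and>
       real (min_edges n r) \<le> 2 powr (C * ((real r)\<^sup>2 / real n) * log 2 (real n / real r)) \<and>
       2 powr (C * ((real r)\<^sup>2 / real n) * log 2 (real n / real r))
         = (real n / real r) powr (C * (real r)\<^sup>2 / real n))"
proof (rule exI[of _ "1 / 2"], rule exI[of _ "204 + 68 * K"], intro conjI allI impI)
  fix r n :: nat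
  assume r: "2 \<le> r" and n: "2 * r - 1 \<le> n" and nK: "real n \<le> K * (real r)\<^sup>2"
  show "2 powr (1 / 2 * (real r)\<^sup>2 / real n) \<le> real (min_edges n r)"
    using r n by (rule min_edges_ge_powr)
  show powr_log: "2 powr ((204 + 68 * K) * ((real r)\<^sup>2 / real n) * log 2 (real n / real r))
      = (real n / real r) powr ((204 + 68 * K) * (real r)\<^sup>2 / real n)"
    using r n by (simp add: powr_def log_def)
  show "real (min_edges n r)
      \<le> 2 powr ((204 + 68 * K) * ((real r)\<^sup>2 / real n) * log 2 (real n / real r))"
    unfolding powr_log using r n nK assms by (rule min_edges_le_powr)
qed (use assms in auto)

end
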